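(* Let $G$ be a group generated by a bounded automaton. Then $\mathrm{WP}_G\in\mathrm{DTIME}_*(n\log n)$.
   Context: An automaton over a finite alphabet $X$ is $A=(S,X,t,o)$ with finite state set $S$, transition map $t:S\times X\to S$, output map $o:S\times X\to X$, extended to words by $t(s,xv)=t(t(s,x),v)$, $o(s,xv)=o(s,x)o(t(s,x),v)$. It is assumed invertible (each $o(s,\cdot)$ permutes $X$), minimal (distinct states define distinct transformations of $X^{*}$), with $S$ closed under inversion; the group it generates is the group of transformations $o(s,\cdot)$ of $X^{*}$. For $s\in S$ and $v\in X^{*}$, $s|_v=t(s,v)$. The trivial state $e$ is the state acting as the identity. The automaton is bounded if there is a constant $C$ such that for every $s\in S$ and $n\in\mathbb{N}$ there are at most $C$ words $v\in X^n$ with $s|_v\neq e$. $\mathrm{WP}_G=\{w\in S^{*}: w=_Ge\}$. $\mathrm{DTIME}_*(t(n))$ is the class of languages decided in time $O(t(n))$ by a deterministic multi-tape Turing machine. *)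

theory Defs
  imports Complex_Main
begin

text \<open>States form a finite type 's (the state set S = UNIV), letters a finite type 'x
(the alphabet X = UNIV). tr is the transition map t, out the output map o.\<close>

fun tw :: "('s \<Rightarrow> 'x \<Rightarrow> 's) \<Rightarrow> 's \<Rightarrow> 'x list \<Rightarrow> 's" where
  "tw tr s [] = s"
| "tw tr s (x # v) = tw tr (tr s x) v"

fun ow :: "('s \<Rightarrow> 'x \<Rightarrow> 's) \<Rightarrow> ('s \<Rightarrow> 'x \<Rightarrow> 'x) \<Rightarrow> 's \<Rightarrow> 'x list \<Rightarrow> 'x list" where
  "ow tr out s [] = []"
| "ow tr out s (x # v) = out s x # ow tr out (tr s x) v"

definition invertible_aut :: "('s \<Rightarrow> 'x \<Rightarrow> 's) \<Rightarrow> ('s \<Rightarrow> 'x \<Rightarrow> 'x) \<Rightarrow> bool" where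
  "invertible_aut tr out \<longleftrightarrow> (\<forall>s. bij (out s))"

definition minimal_aut :: "('s \<Rightarrow> 'x \<Rightarrow> 's) \<Rightarrow> ('s \<Rightarrow> 'x \<Rightarrow> 'x) \<Rightarrow> bool" where
  "minimal_aut tr out \<longleftrightarrow> inj (\<lambda>s. ow tr out s)"

definition inverse_closed_aut :: "('s \<Rightarrow> 'x \<Rightarrow> 's) \<Rightarrow> ('s \<Rightarrow> 'x \<Rightarrow> 'x) \<Rightarrow> bool" where
  "inverse_closed_aut tr out \<longleftrightarrow>
     (\<forall>s. \<exists>s'. (\<forall>v. ow tr out s' (ow tr out s v) = v) \<and> (\<forall>v. ow tr out s (ow tr out s' v) = v))"

definition bounded_aut :: "('s::finite \<Rightarrow> 'x::finite \<Rightarrow> 's) \<Rightarrow> ('s \<Rightarrow> 'x \<Rightarrow> 'x) \<Rightarrow> bool" where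
  "bounded_aut tr out \<longleftrightarrow>
     (\<exists>C::nat. \<forall>s n. card {v :: 'x list. length v = n \<and> ow tr out (tw tr s v) \<noteq> (\<lambda>u. u)} \<le> C)"

definition eval_word :: "('s \<Rightarrow> 'x \<Rightarrow> 's) \<Rightarrow> ('s \<Rightarrow> 'x \<Rightarrow> 'x) \<Rightarrow> 's list \<Rightarrow> ('x list \<Rightarrow> 'x list)" where
  "eval_word tr out w = foldr (\<lambda>s f. ow tr out s \<circ> f) w id"

definition WP :: "('s \<Rightarrow> 'x \<Rightarrow> 's) \<Rightarrow> ('s \<Rightarrow> 'x \<Rightarrow> 'x) \<Rightarrow> 's list set" where
  "WP tr out = {w. eval_word tr out w = id}"

text \<open>States and tape symbols are natural numbers drawn from finite sets; 0 is the blank.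
Input letters of type 's are encoded into non-blank tape symbols by an injective map.
The machine reads the k symbols under the heads and (in a non-halting state) writes k symbols,
moves each head by -1, 0 or +1, and changes state. Tapes are two-way infinite.\<close>

record 's tm =
  ntapes :: nat
  states :: "nat set"
  symbols :: "nat set"
  enc :: "'s \<Rightarrow> nat"
  start :: nat
  accept :: nat
  reject :: nat
  delta :: "nat \<Rightarrow> nat list \<Rightarrow> nat \<times> nat list \<times> int list"

definition wf_tm :: "'s tm \<Rightarrow> bool" where
  "wf_tm M \<longleftrightarrow>
     ntapes M \<ge> 1 \<and> finite (states M) \<and> finite (symbols M) \<and> 0 \<in> symbols M \<and>
     inj (enc M) \<and> range (enc M) \<subseteq> symbols M - {0} \<and>
     start M \<in> states M \<and> accept M \<in> states M \<and> reject M \<in> states M \<and> accept M \<noteq> reject M \<and>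
     (\<forall>q \<in> states M. \<forall>gs. length gs = ntapes M \<and> set gs \<subseteq> symbols M \<longrightarrow>
        (case delta M q gs of (q', ws, ms) \<Rightarrow>
           q' \<in> states M \<and> length ws = ntapes M \<and> set ws \<subseteq> symbols M \<and>
           length ms = ntapes M \<and> set ms \<subseteq> {-1, 0, 1}))"

type_synonym config = "nat \<times> (int \<Rightarrow> nat) list \<times> int list"

definition tm_step :: "'s tm \<Rightarrow> config \<Rightarrow> config" where
  "tm_step M c = (case c of (q, ts, hs) \<Rightarrow>
     if q = accept M \<or> q = reject M then c
     else (case delta M q (map (\<lambda>i. (ts ! i) (hs ! i)) [0..<ntapes M]) of (q', ws, ms) \<Rightarrow>
       (q', map (\<lambda>i. (ts ! i)((hs ! i) := ws ! i)) [0..<ntapes M],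
            map (\<lambda>i. hs ! i + ms ! i) [0..<ntapes M])))"

definition tm_init :: "'s tm \<Rightarrow> 's list \<Rightarrow> config" where
  "tm_init M w = (start M,
     (\<lambda>i. if 0 \<le> i \<and> nat i < length w then enc M (w ! nat i) else 0) # replicate (ntapes M - 1) (\<lambda>_. 0),
     replicate (ntapes M) 0)"

definition tm_run :: "'s tm \<Rightarrow> 's list \<Rightarrow> nat \<Rightarrow> config" where
  "tm_run M w n = (tm_step M ^^ n) (tm_init M w)"

definition tm_halted :: "'s tm \<Rightarrow> 's list \<Rightarrow> nat \<Rightarrow> bool" where
  "tm_halted M w n \<longleftrightarrow> fst (tm_run M w n) \<in> {accept M, reject M}"

definition tm_time :: "'s tm \<Rightarrow> 's list \<Rightarrow> nat" where
  "tm_time M w = (LEAST n. tm_halted M w n)"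

definition tm_decides :: "'s tm \<Rightarrow> 's list set \<Rightarrow> bool" where
  "tm_decides M L \<longleftrightarrow>
     (\<forall>w. (\<exists>n. tm_halted M w n) \<and> (fst (tm_run M w (tm_time M w)) = accept M \<longleftrightarrow> w \<in> L))"

definition DTIME_star :: "(nat \<Rightarrow> real) \<Rightarrow> 's list set set" where
  "DTIME_star T = {L. \<exists>M :: 's tm. wf_tm M \<and> tm_decides M L \<and>
      (\<exists>c N. \<forall>w. length w \<ge> N \<longrightarrow> real (tm_time M w) \<le> c * T (length w))}"

end

(* For a bounded automaton, sections deep in the tree are either finitary or reproduce themselves at
   a single vertex. All products of two such transformations, together with the states, form a finite
   set that contains the deep sections of products of two of its elements (contraction). So a
   word over this set passes to its sections at the vertices of a fixed level L by multiplying out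
   pairs of letters, which halves its length, and it is trivial iff it fixes every vertex of level L
   and all these sections are trivial; after about log n rounds only trivial words may remain.
   A round costs linear time: the number of vertices of a given depth with nontrivial section is
   subadditive under products and, summed over the sections, is the same count at a greater depth,
   so boundedness limits the number of nontrivial letters in all words of a round by C n.
   The rounds are run by a machine with two tapes whose roles alternate. It reads and writes
   towards the left, so that the letters of a product come in the order in which they act. *)
theory Submission
  imports Defs "HOL-Library.FuncSet" "HOL-Library.Countable"
begin

section \<open>Tree automorphisms and their sections\<close>

text \<open>Halving alone does not give linear rounds: every word has |X|^L successors, so the tape
  would grow by a constant factor per round if trivial letters were kept. The bound on the surviving
  letters must moreover not deteriorate over log n rounds. Therefore activity is bounded at all
  depths simultaneously: what is counted at depth j after a round was already counted at depth j + L
  before it, and the same linear bound is an invariant. End markers need a bound of their own. A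
  word of at most one letter is decided on the spot by a finite table and dropped, so only words
  with two letters or more have successors, and their number is at most the total length. On the
  algebraic side, a product of two self-reproducing transformations is again of this kind if their
  distinguished vertices match and both have the same period. A common period m comes from an
  idempotent power of a successor map on the finite state set.\<close>

definition tree_aut :: "('x list \<Rightarrow> 'x list) \<Rightarrow> bool" where
  "tree_aut f \<longleftrightarrow> (\<forall>v. length (f v) = length v) \<and>
     (\<forall>v u. take (length v) (f (v @ u)) = f v) \<and> inj f"

definition sec :: "('x list \<Rightarrow> 'x list) \<Rightarrow> 'x list \<Rightarrow> 'x list \<Rightarrow> 'x list" where
  "sec f v = (\<lambda>u. drop (length v) (f (v @ u)))"

lemma tree_aut_length: "tree_aut f \<Longrightarrow> length (f v) = length v"
  by (simp add: tree_aut_def)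

lemma tree_aut_append: assumes "tree_aut f" shows "f (v @ u) = f v @ sec f v u"
proof -
  have "take (length v) (f (v @ u)) = f v" using assms by (simp add: tree_aut_def)
  then show ?thesis using append_take_drop_id[of "length v" "f (v @ u)"] by (simp add: sec_def)
qed

lemma tree_aut_inj: "tree_aut f \<Longrightarrow> inj f"
  by (simp add: tree_aut_def)

lemma tree_aut_eq_iff: "tree_aut f \<Longrightarrow> f v = f u \<longleftrightarrow> v = u"
  by (meson injD tree_aut_inj)

lemma tree_autI:
  assumes "\<And>v. length (f v) = length v" "\<And>v u. \<exists>z. f (v @ u) = f v @ z" "inj f"
  shows "tree_aut f"
  unfolding tree_aut_def
proof (intro conjI allI)
  fix v u show "take (length v) (f (v @ u)) = f v"
    using assms(1)[of v] assms(2)[of v u] by (metis append_eq_conv_conj)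
qed (use assms in auto)

lemma tree_aut_id [simp]: "tree_aut id"
  by (simp add: tree_aut_def)

lemma tree_aut_comp [intro]:
  assumes f: "tree_aut f" and g: "tree_aut g" shows "tree_aut (f \<circ> g)"
proof (rule tree_autI)
  show "inj (f \<circ> g)" using f g by (simp add: inj_compose tree_aut_inj)
  show "length ((f \<circ> g) v) = length v" for v
    by (simp add: tree_aut_length[OF f] tree_aut_length[OF g])
  show "\<exists>z. (f \<circ> g) (v @ u) = (f \<circ> g) v @ z" for v u
    by (simp add: tree_aut_append[OF f] tree_aut_append[OF g])
qed

lemma sec_id [simp]: "sec id v = id"
  by (auto simp: sec_def)

lemma sec_append: "sec f (v @ u) = sec (sec f v) u"
  by (auto simp: sec_def add.commute)

lemma sec_comp:
  assumes f: "tree_aut f" and g: "tree_aut g"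
  shows "sec (f \<circ> g) v = sec f (g v) \<circ> sec g v"
proof
  fix u
  have "(f \<circ> g) (v @ u) = f (g v) @ sec f (g v) (sec g v u)"
    by (simp add: tree_aut_append[OF f] tree_aut_append[OF g])
  then show "sec (f \<circ> g) v u = (sec f (g v) \<circ> sec g v) u"
    by (simp add: sec_def[of "f \<circ> g"] tree_aut_length[OF f] tree_aut_length[OF g])
qed

lemma tree_aut_sec [intro]: assumes f: "tree_aut f" shows "tree_aut (sec f v)"
proof (rule tree_autI)
  show "length (sec f v u) = length u" for u
    by (simp add: sec_def tree_aut_length[OF f])
  show "\<exists>z. sec f v (u @ u') = sec f v u @ z" for u u'
    using tree_aut_append[OF f, of "v @ u" u'] tree_aut_append[OF f, of v u]
      tree_aut_append[OF f, of v "u @ u'"] by auto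
  show "inj (sec f v)"
  proof (rule injI)
    fix u u' assume "sec f v u = sec f v u'"
    then have "f (v @ u) = f (v @ u')" by (simp add: tree_aut_append[OF f])
    then show "u = u'" by (simp add: tree_aut_eq_iff[OF f])
  qed
qed

abbreviation words :: "nat \<Rightarrow> 'x list set" where
  "words n \<equiv> {v. length v = n}"

lemma finite_words [simp]: "finite (words n :: 'x::finite list set)"
  using finite_lists_length_eq[of "UNIV :: 'x set" n] by simp

lemma finite_words_le: "finite {v :: 'x::finite list. length v \<le> n}"
  using finite_lists_length_le[of "UNIV :: 'x set" n] by simp

text \<open>On a finite level injectivity yields surjectivity, so \<open>inj\<close> suffices in
  \<open>tree_aut\<close> to describe automorphisms of the tree.\<close>

lemma tree_aut_bij_words:
  fixes f :: "'x::finite list \<Rightarrow> 'x list"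
  assumes "tree_aut f" shows "bij_betw f (words n) (words n)"
proof -
  have i: "inj_on f (words n)" using tree_aut_inj[OF assms] inj_on_subset by blast
  have "f ` words n \<subseteq> words n" by (auto simp: tree_aut_length[OF assms])
  then have "f ` words n = words n" by (simp add: endo_inj_surj i)
  then show ?thesis using i by (simp add: bij_betw_def)
qed

lemma sec_eq_id_trans: "sec f v = id \<Longrightarrow> sec f (v @ u) = id"
  by (simp add: sec_append)

lemma tree_aut_eq_id_iff:
  fixes f :: "'x list \<Rightarrow> 'x list"
  assumes f: "tree_aut f"
  shows "f = id \<longleftrightarrow> (\<forall>v\<in>words n. f v = v \<and> sec f v = id)"
proof
  assume r: "\<forall>v\<in>words n. f v = v \<and> sec f v = id"
  have long: "f w = w" if "n \<le> length w" for w
    using that r tree_aut_append[OF f, of "take n w" "drop n w"] by simp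
  show "f = id"
  proof
    fix w
    \<comment> \<open>A word shorter than n is padded to a long one, whose image has the image of w
      as a prefix.\<close>
    have "f (w @ replicate n undefined) = w @ replicate n undefined" by (rule long) simp
    then show "f w = id w" by (simp add: tree_aut_append[OF f] tree_aut_length[OF f])
  qed
qed simp

section \<open>Counting nontrivial sections\<close>

text \<open>Sidki's activity of f on level n; \<open>bounded_aut\<close> bounds it for all states,
  uniformly in n.\<close>

definition act :: "nat \<Rightarrow> ('x list \<Rightarrow> 'x list) \<Rightarrow> nat" where
  "act n f = card {v \<in> words n. sec f v \<noteq> id}"

lemma act_0: "act 0 f = (if f = id then 0 else 1)"
proof -
  have "sec f [] = f" by (auto simp: sec_def)
  then have "{v \<in> words 0. sec f v \<noteq> id} = (if f = id then {} else {[]})" by auto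
  then show ?thesis unfolding act_def by simp
qed

lemma sum_act_sec:
  fixes f :: "'x::finite list \<Rightarrow> 'x list"
  shows "(\<Sum>v\<in>words n. act k (sec f v)) = act (k + n) f"
proof -
  have "act (k + n) f = card (SIGMA v:words n. {u \<in> words k. sec (sec f v) u \<noteq> id})"
    unfolding act_def
  proof (rule bij_betw_same_card[symmetric])
    show "bij_betw (\<lambda>(v, u). v @ u) (SIGMA v:words n. {u \<in> words k. sec (sec f v) u \<noteq> id})
      {v \<in> words (k + n). sec f v \<noteq> id}"
      by (rule bij_betw_byWitness[where f' = "\<lambda>w. (take n w, drop n w)"])
        (auto simp: sec_append simp flip: sec_append)
  qed
  also have "\<dots> = (\<Sum>v\<in>words n. act k (sec f v))"
    unfolding act_def by (subst card_SigmaI) auto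
  finally show ?thesis by simp
qed

text \<open>In \<open>sec f (g v) \<circ> sec g v\<close> some factor is nontrivial if the product
  is. As g is injective and preserves length, the vertices v counted through f inject into those of
  \<open>act n f\<close>.\<close>

lemma act_comp:
  fixes f g :: "'x::finite list \<Rightarrow> 'x list"
  assumes f: "tree_aut f" and g: "tree_aut g"
  shows "act n (f \<circ> g) \<le> act n f + act n g"
proof -
  have "{v \<in> words n. sec (f \<circ> g) v \<noteq> id} \<subseteq>
      {v \<in> words n. sec f (g v) \<noteq> id} \<union> {v \<in> words n. sec g v \<noteq> id}"
    by (auto simp: sec_comp[OF f g])
  then have "act n (f \<circ> g) \<le>
      card ({v \<in> words n. sec f (g v) \<noteq> id} \<union> {v \<in> words n. sec g v \<noteq> id})"
    unfolding act_def by (intro card_mono) auto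
  also have "\<dots> \<le> card {v \<in> words n. sec f (g v) \<noteq> id} + act n g"
    unfolding act_def by (rule card_Un_le)
  also have "card {v \<in> words n. sec f (g v) \<noteq> id} \<le> act n f"
    unfolding act_def
  proof (rule card_inj_on_le)
    show "inj_on g {v \<in> words n. sec f (g v) \<noteq> id}"
      using tree_aut_inj[OF g] inj_on_subset by blast
  qed (auto simp: tree_aut_length[OF g])
  finally show ?thesis by simp
qed

section \<open>The nucleus of a bounded automaton\<close>

definition finitary :: "nat \<Rightarrow> ('x list \<Rightarrow> 'x list) set" where
  "finitary m = {f. tree_aut f \<and> (\<forall>v\<in>words m. sec f v = id)}"

text \<open>A copy of f hangs below x. The vertex x need not be fixed by f, so whether two such maps
  compose well depends on the image of x.\<close>

definition directed_at :: "nat \<Rightarrow> 'x list \<Rightarrow> ('x list \<Rightarrow> 'x list) set" where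
  "directed_at m x = {f. tree_aut f \<and> sec f x = f \<and> (\<forall>y\<in>words m - {x}. sec f y \<in> finitary m)}"

definition core :: "nat \<Rightarrow> ('x list \<Rightarrow> 'x list) set" where
  "core m = finitary m \<union> (\<Union>x\<in>words m. directed_at m x)"

lemma finitary_eqI:
  assumes "f \<in> finitary m" "g \<in> finitary m" "\<And>v. length v \<le> m \<Longrightarrow> f v = g v"
  shows "f = g"
proof
  fix v
  show "f v = g v"
  proof (cases "length v \<le> m")
    case False
    then have l: "length (take m v) = m" by simp
    have "h v = h (take m v) @ drop m v" if "h \<in> finitary m" for h
      using that l tree_aut_append[of h "take m v" "drop m v"] unfolding finitary_def by auto
    then show ?thesis using assms l by (metis order_refl)
  qed (use assms in auto)
qed

text \<open>Off x the sections act on their first m letters only, which words of length up to 2m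
  reveal. Below x the map repeats itself, so induction on the length peels off m letters at a
  time.\<close>

lemma directed_at_eqI:
  assumes m: "0 < m" and x: "length x = m"
    and fg: "f \<in> directed_at m x" "g \<in> directed_at m x"
    and eq: "\<And>v. length v \<le> 2 * m \<Longrightarrow> f v = g v"
  shows "f = g"
proof
  have ta: "tree_aut f" "tree_aut g" using fg by (auto simp: directed_at_def)
  have secs: "sec f y = sec g y" if "length y = m" "y \<noteq> x" for y
  proof (rule finitary_eqI)
    show "sec f y \<in> finitary m" "sec g y \<in> finitary m" using fg that by (auto simp: directed_at_def)
    show "sec f y v = sec g y v" if "length v \<le> m" for v
      using eq[of "y @ v"] \<open>length y = m\<close> that by (simp add: sec_def)
  qed
  fix v show "f v = g v"
  proof (induction v rule: length_induct)
    case (1 v)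
    show ?case
    proof (cases "length v \<le> 2 * m")
      case False
      then have l: "length (take m v) = m" and s: "length (drop m v) < length v" using m by auto
      have split: "h v = h (take m v) @ sec h (take m v) (drop m v)" if "tree_aut h" for h
        using tree_aut_append[OF that, of "take m v" "drop m v"] by simp
      have "f (take m v) = g (take m v)" using eq l by simp
      moreover have "sec f (take m v) (drop m v) = sec g (take m v) (drop m v)"
      proof (cases "take m v = x")
        case True
        then show ?thesis using fg 1 s by (auto simp: directed_at_def)
      qed (use secs l in auto)
      ultimately show ?thesis using split ta by metis
    qed (use eq in auto)
  qed
qed

lemma finite_if_determined:
  fixes A :: "('x::finite list \<Rightarrow> 'x list) set"
  assumes "\<And>f. f \<in> A \<Longrightarrow> tree_aut f"
    and "\<And>f g. f \<in> A \<Longrightarrow> g \<in> A \<Longrightarrow> (\<And>v. length v \<le> n \<Longrightarrow> f v = g v) \<Longrightarrow> f = g"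
  shows "finite A"
proof -
  let ?W = "{v :: 'x list. length v \<le> n}"
  have "inj_on (\<lambda>f. restrict f ?W) A"
  proof (rule inj_onI)
    fix f g assume fg: "f \<in> A" "g \<in> A" "restrict f ?W = restrict g ?W"
    show "f = g"
    proof (rule assms(2)[OF fg(1,2)])
      show "f v = g v" if "length v \<le> n" for v
        using fun_cong[OF fg(3), of v] that by simp
    qed
  qed
  moreover have "(\<lambda>f. restrict f ?W) ` A \<subseteq> ?W \<rightarrow>\<^sub>E ?W"
    by (auto simp: tree_aut_length[OF assms(1)] restrict_def PiE_def extensional_def)
  moreover have "finite (?W \<rightarrow>\<^sub>E ?W)"
    by (intro finite_PiE finite_words_le)
  ultimately show ?thesis
    using finite_imageD finite_subset by blast
qed

lemma finite_core: "0 < m \<Longrightarrow> finite (core m :: ('x::finite list \<Rightarrow> 'x list) set)"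
  unfolding core_def
proof (intro finite_UnI finite_UN_I)
  show "finite (finitary m :: ('x list \<Rightarrow> 'x list) set)"
    by (rule finite_if_determined[where n = m]) (auto simp: finitary_def intro: finitary_eqI[of _ m])
  show "finite (directed_at m x)" if "0 < m" "x \<in> words m" for x :: "'x list"
    using that
    by (intro finite_if_determined[where n = "2 * m"]) (auto simp: directed_at_def intro: directed_at_eqI[of m x])
qed auto

section \<open>Closure properties and contraction of the core\<close>

lemma id_finitary [simp]: "id \<in> finitary m"
  by (simp add: finitary_def)

lemma finitary_comp: "f \<in> finitary m \<Longrightarrow> g \<in> finitary m \<Longrightarrow> f \<circ> g \<in> finitary m"
  by (simp add: finitary_def sec_comp[of f g] tree_aut_length[of g] tree_aut_comp)

lemma core_tree_aut: "f \<in> core m \<Longrightarrow> tree_aut f"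
  by (auto simp: core_def finitary_def directed_at_def)

lemma finitary_core: "f \<in> finitary m \<Longrightarrow> f \<in> core m"
  by (simp add: core_def)

lemma core_sec: assumes "f \<in> core m" "length v = m" shows "sec f v \<in> core m"
proof (cases "f \<in> finitary m")
  case True
  then show ?thesis using assms by (simp add: finitary_def core_def)
next
  case False
  then obtain x where x: "length x = m" "f \<in> directed_at m x" using assms by (auto simp: core_def)
  then show ?thesis using assms by (cases "v = x") (auto simp: directed_at_def core_def)
qed

text \<open>By injectivity a vertex other than x is sent by g to one other than \<open>g x\<close>,
  so there both factors have finitary sections.\<close>

lemma directed_at_comp:
  assumes f: "f \<in> directed_at m (g x)" and g: "g \<in> directed_at m x" and "length x = m"
  shows "f \<circ> g \<in> directed_at m x"
proof -
  have ta: "tree_aut f" "tree_aut g" using assms by (auto simp: directed_at_def)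
  have "sec (f \<circ> g) y \<in> finitary m" if "length y = m" "y \<noteq> x" for y
  proof -
    have "g y \<noteq> g x" using ta that by (simp add: tree_aut_eq_iff[of g])
    then show ?thesis using assms ta that
      by (auto simp: directed_at_def sec_comp[of f g] tree_aut_length[of g] intro!: finitary_comp)
  qed
  then show ?thesis using assms ta by (auto simp: directed_at_def sec_comp[of f g])
qed

text \<open>After m letters there are two cases. Either the path runs through the directed vertices
  of both factors, and then the product itself is directed; or one of the two sections is finitary
  and vanishes within the next m letters, leaving a single element of the core.\<close>

lemma core_comp_sec:
  assumes f: "f \<in> core m" and g: "g \<in> core m" and v: "length v = 2 * m"
  shows "sec (f \<circ> g) v \<in> core m"
proof -
  note ta = core_tree_aut[OF f] core_tree_aut[OF g]
  obtain a b where ab: "v = a @ b" "length a = m" "length b = m"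
    using v by (metis append_take_drop_id length_drop length_take min.absorb4 mult_2 add_diff_cancel_left' le_add1 min.absorb2)
  have ts: "tree_aut (sec f (g a))" "tree_aut (sec g a)" using ta by auto
  have eq: "sec (f \<circ> g) v = sec (sec f (g a)) (sec g a b) \<circ> sec (sec g a) b"
    using ab by (simp add: sec_append sec_comp[OF ta] sec_comp[OF ts])
  have la: "length (g a) = m" and lb: "length (sec g a b) = m"
    using ab by (simp_all add: tree_aut_length[OF ta(2)] tree_aut_length[OF ts(2)])
  have cs: "sec (sec f (g a)) (sec g a b) \<in> core m" "sec (sec g a) b \<in> core m"
    using f g la lb ab by (auto intro!: core_sec)
  have gfin: ?thesis if "sec g a \<in> finitary m"
    using that eq cs ab by (simp add: finitary_def)
  have ffin: ?thesis if "sec f (g a) \<in> finitary m"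
    using that eq cs lb by (simp add: finitary_def)
  consider "f \<in> finitary m" | "g \<in> finitary m" | x y where "length x = m" "length y = m"
    "f \<in> directed_at m x" "g \<in> directed_at m y"
    using f g by (auto simp: core_def)
  then show ?thesis
  proof cases
    case 1
    then have "sec f (g a) = id" using la by (simp add: finitary_def)
    then show ?thesis using ffin by simp
  next
    case 2
    then have "sec g a = id" using ab by (simp add: finitary_def)
    then show ?thesis using gfin by simp
  next
    case (3 x y)
    consider "a \<noteq> y" | "g a \<noteq> x" | "a = y" "g y = x" by auto
    then show ?thesis
    proof cases
      case 1 then show ?thesis using gfin 3 ab by (simp add: directed_at_def)
    next
      case 2 then show ?thesis using ffin 3 la by (simp add: directed_at_def)
    next
      case c: 3
      then have "f \<circ> g \<in> core m" using directed_at_comp[of f m g y] 3 by (auto simp: core_def)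
      then show ?thesis using ab by (simp add: sec_append core_sec)
    qed
  qed
qed

section \<open>States as tree automorphisms\<close>

lemma ow_length [simp]: "length (ow tr out s v) = length v"
  by (induction v arbitrary: s) auto

lemma ow_append: "ow tr out s (v @ u) = ow tr out s v @ ow tr out (tw tr s v) u"
  by (induction v arbitrary: s) simp_all

lemma tw_append: "tw tr s (v @ u) = tw tr (tw tr s v) u"
  by (induction v arbitrary: s) auto

lemma sec_ow: "sec (ow tr out s) v = ow tr out (tw tr s v)"
  by (auto simp: sec_def ow_append)

lemma tree_aut_ow: assumes "invertible_aut tr out" shows "tree_aut (ow tr out s)"
proof (rule tree_autI)
  have "ow tr out s v = ow tr out s u \<Longrightarrow> v = u" for v u
  proof (induction v arbitrary: s u)
    case Nil
    then show ?case by (metis ow_length length_0_conv)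
  next
    case (Cons a v)
    then obtain b u' where u: "u = b # u'" by (cases u) auto
    have "a = b" using Cons.prems u assms by (auto simp: invertible_aut_def bij_def dest: injD)
    then show ?case using Cons u by auto
  qed
  then show "inj (ow tr out s)" by (auto intro: injI)
qed (auto simp: ow_append)

text \<open>Every element of a finite semigroup has an idempotent power, and its exponent can be
  taken large.\<close>

lemma funpow_idempotent:
  fixes f :: "'s::finite \<Rightarrow> 's"
  shows "\<exists>m\<ge>k. 0 < m \<and> f ^^ (m + m) = f ^^ m"
proof -
  have "\<not> inj (\<lambda>n. f ^^ n)"
    using finite_imageD[of "\<lambda>n. f ^^ n" UNIV] by auto
  then obtain i j where "i < j" "f ^^ i = f ^^ j"
    by (auto simp: inj_def neq_iff)
  then obtain i p where p: "0 < p" "f ^^ i = f ^^ (i + p)"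
    using less_imp_add_positive[of i j] by auto
  have step: "f ^^ (a + p) = f ^^ a" if "i \<le> a" for a
  proof -
    have "f ^^ (a + p) = f ^^ ((a - i) + (i + p))" using that by simp
    also have "\<dots> = f ^^ ((a - i) + i)" by (simp only: funpow_add[of "a - i"] flip: p(2))
    finally show ?thesis using that by simp
  qed
  have many: "f ^^ (a + r * p) = f ^^ a" if "i \<le> a" for a r
  proof (induction r)
    case (Suc r)
    have "f ^^ (a + Suc r * p) = f ^^ ((a + r * p) + p)" by (simp add: algebra_simps)
    also have "\<dots> = f ^^ (a + r * p)" by (rule step) (use that in simp)
    finally show ?case using Suc by simp
  qed simp
  \<comment> \<open>A multiple of the period p beyond the preperiod i and beyond k; adding ?m once
    more adds i + k + 1 full periods.\<close>
  let ?m = "(i + k + 1) * p"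
  have "i + k + 1 \<le> ?m" using p by (cases p) auto
  then show ?thesis using many[of ?m "i + k + 1"] by (intro exI[of _ ?m]) auto
qed

section \<open>Infinitary states of a bounded automaton\<close>

locale bounded_invertible =
  fixes tr :: "'s::finite \<Rightarrow> 'x::finite \<Rightarrow> 's" and out :: "'s \<Rightarrow> 'x \<Rightarrow> 'x"
  assumes inv: "invertible_aut tr out" and bdd: "bounded_aut tr out"
begin

abbreviation "tf \<equiv> ow tr out"

lemma ta [simp]: "tree_aut (tf s)"
  by (rule tree_aut_ow[OF inv])

definition infinitary :: "'s \<Rightarrow> bool" where
  "infinitary s \<longleftrightarrow> (\<forall>n. \<exists>v\<in>words n. tf (tw tr s v) \<noteq> id)"

lemma act_tf: "act n (tf s) = card {v \<in> words n. tf (tw tr s v) \<noteq> id}"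
  by (simp add: act_def sec_ow)

lemma act_bounded: "\<exists>C. \<forall>s n. act n (tf s) \<le> C"
  using bdd unfolding bounded_aut_def act_tf id_def by auto

lemma trivial_later:
  assumes "\<forall>v\<in>words n. tf (tw tr s v) = id" "n \<le> k" shows "\<forall>v\<in>words k. tf (tw tr s v) = id"
proof
  fix v :: "'x list" assume "v \<in> words k"
  then have "tf (tw tr s (take n v)) = id" using assms by simp
  then have "sec (tf s) (take n v @ drop n v) = id" by (intro sec_eq_id_trans) (simp add: sec_ow)
  then show "tf (tw tr s v) = id" by (simp add: sec_ow)
qed

lemma not_infinitary_depth: "\<exists>d. \<forall>s. \<not> infinitary s \<longrightarrow> (\<forall>m\<ge>d. tf s \<in> finitary m)"
proof -
  have "\<forall>s. \<exists>n. \<not> infinitary s \<longrightarrow> (\<forall>v\<in>words n. tf (tw tr s v) = id)"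
    by (auto simp: infinitary_def)
  then obtain n where n: "\<And>s. \<not> infinitary s \<Longrightarrow> \<forall>v\<in>words (n s). tf (tw tr s v) = id" by metis
  have "tf s \<in> finitary m" if "\<not> infinitary s" "Max (range n) \<le> m" for s m
  proof -
    have "n s \<le> Max (range n)" by simp
    then have "n s \<le> m" using that(2) by linarith
    then have "\<forall>v\<in>words m. tf (tw tr s v) = id" by (rule trivial_later[OF n[OF that(1)]])
    then show ?thesis by (simp add: finitary_def sec_ow)
  qed
  then show ?thesis by blast
qed

text \<open>If no child were infinitary, all children would become trivial at one common depth d,
  and s itself at depth d + 1.\<close>

lemma infinitary_child: assumes "infinitary s" shows "\<exists>x. infinitary (tr s x)"
proof (rule ccontr)
  assume a: "\<nexists>x. infinitary (tr s x)"
  obtain d where d: "\<And>s. \<not> infinitary s \<Longrightarrow> tf s \<in> finitary d"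
    using not_infinitary_depth by blast
  obtain v where v: "v \<in> words (Suc d)" "tf (tw tr s v) \<noteq> id"
    using assms by (auto simp: infinitary_def)
  then obtain x u where "v = x # u" by (cases v) auto
  then show False using v a d by (auto simp: finitary_def sec_ow)
qed

definition inf_secs :: "nat \<Rightarrow> 's \<Rightarrow> 'x list set" where
  "inf_secs n s = {v \<in> words n. infinitary (tw tr s v)}"

definition next_inf :: "'s \<Rightarrow> 'x" where
  "next_inf s = (SOME x. infinitary (tr s x))"

text \<open>Choosing one infinitary child per state turns an infinite path into the orbit of a
  self-map of the finite state set, to which \<open>funpow_idempotent\<close> applies.\<close>

definition succ_inf :: "'s \<Rightarrow> 's" where
  "succ_inf s = tr s (next_inf s)"

lemma infinitary_succ: "infinitary s \<Longrightarrow> infinitary (succ_inf s)"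
  unfolding succ_inf_def next_inf_def by (rule someI_ex) (rule infinitary_child)

lemma succ_path: "infinitary s \<Longrightarrow> \<exists>v\<in>inf_secs n s. tw tr s v = (succ_inf ^^ n) s"
proof (induction n arbitrary: s)
  case (Suc n)
  from Suc.IH[OF infinitary_succ[OF Suc.prems]] obtain v where
    "v \<in> inf_secs n (succ_inf s)" "tw tr (succ_inf s) v = (succ_inf ^^ n) (succ_inf s)" by auto
  then show ?case
    by (intro bexI[of _ "next_inf s # v"])
      (simp_all add: inf_secs_def funpow_swap1 flip: succ_inf_def)
qed (auto simp: inf_secs_def)

lemma finite_inf_secs [simp]: "finite (inf_secs n s)"
  by (simp add: inf_secs_def)

lemma card_inf_secs_bounded: "\<exists>C. \<forall>s n. card (inf_secs n s) \<le> C"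
proof -
  obtain C where C: "\<And>s n. act n (tf s) \<le> C" using act_bounded by auto
  have "inf_secs n s \<subseteq> {v \<in> words n. tf (tw tr s v) \<noteq> id}" for n s
    by (force simp: inf_secs_def infinitary_def)
  then have "card (inf_secs n s) \<le> act n (tf s)" for n s
    unfolding act_tf by (intro card_mono) auto
  then show ?thesis using C by (metis order_trans)
qed

lemma card_inf_secs_add:
  "card (inf_secs (n + k) s) = (\<Sum>v\<in>inf_secs n s. card (inf_secs k (tw tr s v)))"
proof -
  \<comment> \<open>Ancestors of infinitary sections are infinitary; hence cutting a word at level n
    lands in \<open>inf_secs n s\<close>.\<close>
  have later: "infinitary t" if "infinitary (tw tr t u)" for t u
  proof (rule ccontr)
    obtain d where d: "\<And>s. \<not> infinitary s \<Longrightarrow> tf s \<in> finitary d"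
      using not_infinitary_depth by blast
    assume "\<not> infinitary t"
    then have "tf t \<in> finitary d" by (rule d)
    obtain z where "z \<in> words d" "tf (tw tr (tw tr t u) z) \<noteq> id"
      using \<open>infinitary (tw tr t u)\<close> by (auto simp: infinitary_def)
    moreover have "\<forall>v\<in>words d. tf (tw tr t v) = id"
      using \<open>tf t \<in> finitary d\<close> by (simp add: finitary_def sec_ow)
    then have "\<forall>v\<in>words (length u + d). tf (tw tr t v) = id"
      by (rule trivial_later) simp
    then have "length (u @ z) = length u + d \<Longrightarrow> tf (tw tr t (u @ z)) = id" by blast
    ultimately show False by (simp add: tw_append)
  qed
  have "card (inf_secs (n + k) s) = card (SIGMA v:inf_secs n s. inf_secs k (tw tr s v))"
  proof (rule bij_betw_same_card[symmetric])
    show "bij_betw (\<lambda>(v, u). v @ u) (SIGMA v:inf_secs n s. inf_secs k (tw tr s v)) (inf_secs (n + k) s)"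
    proof (rule bij_betw_byWitness[where f' = "\<lambda>w. (take n w, drop n w)"])
      show "(\<lambda>w. (take n w, drop n w)) ` inf_secs (n + k) s
          \<subseteq> (SIGMA v:inf_secs n s. inf_secs k (tw tr s v))"
      proof (rule image_subsetI)
        fix w assume "w \<in> inf_secs (n + k) s"
        moreover have "tw tr s w = tw tr (tw tr s (take n w)) (drop n w)" by (simp flip: tw_append)
        ultimately show "(take n w, drop n w) \<in> (SIGMA v:inf_secs n s. inf_secs k (tw tr s v))"
          using later[of "tw tr s (take n w)" "drop n w"] by (simp add: inf_secs_def)
      qed
    qed (auto simp: inf_secs_def tw_append)
  qed
  then show ?thesis by (subst (asm) card_SigmaI) auto
qed

lemma card_inf_secs_pos: "infinitary s \<Longrightarrow> 1 \<le> card (inf_secs n s)"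
  using succ_path[of s n] by (metis One_nat_def Suc_leI card_gt_0_iff empty_iff finite_inf_secs)

text \<open>The number of infinitary sections at level \<open>n\<close> is bounded and nondecreasing in \<open>n\<close>, hence
eventually constant; from then on an infinitary section has just one infinitary section per level.\<close>

lemma unique_inf_secs:
  "\<exists>d. \<forall>s v. d \<le> length v \<longrightarrow> infinitary (tw tr s v) \<longrightarrow> (\<forall>k. card (inf_secs k (tw tr s v)) = 1)"
proof -
  obtain C where C: "\<And>s n. card (inf_secs n s) \<le> C" using card_inf_secs_bounded by auto
  have mono: "card (inf_secs n s) \<le> card (inf_secs (n + k) s)" for n k s
  proof -
    have "card (inf_secs n s) = (\<Sum>v\<in>inf_secs n s. 1)" by simp
    also have "\<dots> \<le> card (inf_secs (n + k) s)"
      unfolding card_inf_secs_add by (rule sum_mono) (rule card_inf_secs_pos, simp add: inf_secs_def)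
    finally show ?thesis .
  qed
  have "\<exists>n. \<forall>k. card (inf_secs k s) \<le> card (inf_secs n s)" for s
  proof -
    let ?A = "range (\<lambda>n. card (inf_secs n s))"
    have "finite ?A" using C by (intro finite_subset[of ?A "{..C}"]) auto
    then have "Max ?A \<in> ?A" by (intro Max_in) auto
    then obtain n where "card (inf_secs n s) = Max ?A" by auto
    then show ?thesis using \<open>finite ?A\<close> by (intro exI[of _ n]) auto
  qed
  then obtain n where n: "\<And>s k. card (inf_secs k s) \<le> card (inf_secs (n s) s)" by metis
  let ?d = "Max (range n)"
  have "card (inf_secs k (tw tr s v)) = 1" if "?d \<le> length v" "infinitary (tw tr s v)" for s v k
  proof (rule ccontr)
    assume "card (inf_secs k (tw tr s v)) \<noteq> 1"
    then have k: "1 < card (inf_secs k (tw tr s v))"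
      using card_inf_secs_pos[OF that(2), of k] by linarith
    \<comment> \<open>Two infinitary descendants of one section on one level would push the total at
      level ?l + k above that at level ?l, which is already maximal.\<close>
    let ?l = "length v"
    have "card (inf_secs ?l s) = (\<Sum>v\<in>inf_secs ?l s. 1)" by simp
    also have "\<dots> < card (inf_secs (?l + k) s)"
      unfolding card_inf_secs_add
    proof (rule sum_strict_mono_ex1)
      show "\<forall>u\<in>inf_secs ?l s. 1 \<le> card (inf_secs k (tw tr s u))"
        by (intro ballI card_inf_secs_pos) (simp add: inf_secs_def)
      show "\<exists>u\<in>inf_secs ?l s. 1 < card (inf_secs k (tw tr s u))"
        using that k by (intro bexI[of _ v]) (simp_all add: inf_secs_def)
    qed simp
    also have "\<dots> \<le> card (inf_secs (n s) s)" by (rule n)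
    also have "n s \<le> ?l" using that(1) by (simp)
    then have "card (inf_secs (n s) s) \<le> card (inf_secs ?l s)"
      using mono[of "n s" s "?l - n s"] by simp
    finally show False by simp
  qed
  then show ?thesis by blast
qed

text \<open>The depth 2m is spent in two blocks. The first m letters leave the part of the tree
  where infinitary sections still branch; the next m letters put the state on a cycle of
  \<open>succ_inf\<close> whose length divides m. There the state returns to itself at one vertex of
  level m, and all other sections are finitary.\<close>

lemma eventually_core: "\<exists>m>0. \<forall>s. \<forall>v\<in>words (2 * m). sec (tf s) v \<in> core m"
proof -
  obtain d where d: "\<And>s m. \<not> infinitary s \<Longrightarrow> d \<le> m \<Longrightarrow> tf s \<in> finitary m"
    using not_infinitary_depth by blast
  obtain e where e: "\<And>s v k. e \<le> length v \<Longrightarrow> infinitary (tw tr s v) \<Longrightarrow> card (inf_secs k (tw tr s v)) = 1"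
    using unique_inf_secs by blast
  txt \<open>Idempotence makes every state reached by \<open>m\<close> infinitary steps return to itself after \<open>m\<close> more.\<close>
  obtain m where m: "d + e \<le> m" "0 < m" "succ_inf ^^ (m + m) = succ_inf ^^ m"
    using funpow_idempotent by blast
  have unique: "tw tr t v = (succ_inf ^^ m) t \<and> inf_secs m t = {v}"
    if "v \<in> inf_secs m t" "card (inf_secs m t) = 1" "infinitary t" for t v
    using that succ_path[of t m] by (metis card_1_singletonE singletonD)
  have "tf (tw tr s v) \<in> core m" if v: "v \<in> words (2 * m)" for s v
  proof -
    define t where "t = tw tr s (take m v)"
    define t' where "t' = tw tr t (drop m v)"
    have tv: "tw tr s v = t'" unfolding t_def t'_def by (simp flip: tw_append)
    show ?thesis
    proof (cases "infinitary t'")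
      case False
      then show ?thesis using d m tv by (auto intro: finitary_core)
    next
      case inf': True
      have inf: "infinitary t"
      proof (rule ccontr)
        assume "\<not> infinitary t"
        then have "tf t \<in> finitary m" using d m by auto
        then have "tf t' = id" using v by (auto simp: t'_def finitary_def sec_ow)
        moreover have "\<exists>u\<in>words 0. tf (tw tr t' u) \<noteq> id" using inf' unfolding infinitary_def by blast
        ultimately show False by simp
      qed
      have c: "card (inf_secs m t) = 1" using e[of "take m v" s] inf m v by (simp add: t_def)
      have c': "card (inf_secs m t') = 1" using e[of v s] inf' m v by (simp add: tv)
      have "drop m v \<in> inf_secs m t" using inf' v by (simp add: inf_secs_def t'_def)
      then have t': "t' = (succ_inf ^^ m) t" using unique c inf t'_def by blast
      obtain x where x: "x \<in> inf_secs m t'" "tw tr t' x = (succ_inf ^^ m) t'"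
        using succ_path[OF inf'] by blast
      have "(succ_inf ^^ m) t' = t'" unfolding t' using m(3) by (metis comp_apply funpow_add)
      moreover have "tf (tw tr t' y) \<in> finitary m" if "y \<in> words m - {x}" for y
      proof -
        have "y \<notin> inf_secs m t'" using unique[OF x(1) c' inf'] that by simp
        then show ?thesis using that d m by (simp add: inf_secs_def)
      qed
      ultimately have "tf t' \<in> directed_at m x"
        using x by (simp add: directed_at_def sec_ow)
      then show ?thesis using tv x by (auto simp: core_def inf_secs_def)
    qed
  qed
  then show ?thesis using m(2) by (auto simp: sec_ow)
qed

text \<open>At depth 2m every element of \<open>NN\<close> has its sections in the core: the states
  by \<open>eventually_core\<close>, the products by \<open>core_comp_sec\<close>. A section of a
  product of two elements is thus a product of two core elements, and these were put into
  \<open>NN\<close>.\<close>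

lemma nucleus_exists:
  "\<exists>NN L. finite NN \<and> id \<in> NN \<and> range tf \<subseteq> NN \<and> (\<forall>g\<in>NN. tree_aut g) \<and>
     (\<forall>g\<in>NN. \<forall>h\<in>NN. \<forall>v\<in>words L. sec (g \<circ> h) v \<in> NN)"
proof -
  obtain m where m: "0 < m" "\<And>s v. length v = 2 * m \<Longrightarrow> sec (tf s) v \<in> core m"
    using eventually_core by auto
  define NN where "NN = range tf \<union> (\<lambda>(f, g). f \<circ> g) ` (core m \<times> core m)"
  have ta: "tree_aut g" if "g \<in> NN" for g
    using that by (auto simp: NN_def intro: core_tree_aut)
  have c: "sec g v \<in> core m" if "g \<in> NN" "length v = 2 * m" for g v
    using that m by (auto simp: NN_def core_comp_sec)
  show ?thesis
  proof (intro exI[of _ NN] exI[of _ "2 * m"] conjI ballI)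
    show "finite NN" using finite_core[OF m(1)] by (auto simp: NN_def)
    have "(id, id) \<in> core m \<times> core m" by (simp add: finitary_core)
    then have "id \<circ> id \<in> NN" unfolding NN_def by (intro UnI2 image_eqI[of _ _ "(id, id)"]) auto
    then show "id \<in> NN" by simp
    show "range tf \<subseteq> NN" by (simp add: NN_def)
    show "tree_aut g" if "g \<in> NN" for g using that by (rule ta)
    fix g h and v :: "'x list" assume gh: "g \<in> NN" "h \<in> NN" "v \<in> words (2 * m)"
    then have "sec (g \<circ> h) v = sec g (h v) \<circ> sec h v" using ta by (simp add: sec_comp[of g h])
    moreover have "sec g (h v) \<in> core m" "sec h v \<in> core m"
      using gh c by (auto simp: tree_aut_length[OF ta])
    ultimately show "sec (g \<circ> h) v \<in> NN" by (force simp: NN_def)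
  qed
qed

end

section \<open>Iterated transducers on a two-tape machine\<close>

definition reaches :: "'s tm \<Rightarrow> nat \<Rightarrow> config \<Rightarrow> config \<Rightarrow> bool" where
  "reaches M n x y \<longleftrightarrow> (\<exists>k\<le>n. (tm_step M ^^ k) x = y)"

lemma reaches_refl [simp]: "reaches M n x x"
  unfolding reaches_def by (rule exI[of _ 0]) simp

lemma reaches_trans:
  assumes "reaches M n x y" "reaches M m y z" shows "reaches M (n + m) x z"
proof -
  obtain k l where "k \<le> n" "(tm_step M ^^ k) x = y" "l \<le> m" "(tm_step M ^^ l) y = z"
    using assms by (auto simp: reaches_def)
  then have "(tm_step M ^^ (l + k)) x = z" "l + k \<le> n + m" by (simp_all add: funpow_add)
  then show ?thesis unfolding reaches_def by blast
qed

lemma reaches_mono: "reaches M n x y \<Longrightarrow> n \<le> m \<Longrightarrow> reaches M m x y"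
  unfolding reaches_def using order_trans by blast

lemma reaches_step:
  assumes "tm_step M x = y" "reaches M n y z" shows "reaches M (Suc n) x z"
proof -
  have "reaches M 1 x y" unfolding reaches_def using assms(1) by (intro exI[of _ 1]) simp
  from reaches_trans[OF this assms(2)] show ?thesis by simp
qed

lemma decides_in_timeI:
  fixes M :: "'s tm"
  assumes M: "wf_tm M"
    and r: "\<And>w. \<exists>y. reaches M (t w) (tm_init M w) y \<and> fst y = (if w \<in> L then accept M else reject M)"
  shows "tm_decides M L" and "tm_time M w \<le> t w"
proof -
  have main: "tm_halted M w (tm_time M w) \<and> tm_time M w \<le> t w \<and>
      fst (tm_run M w (tm_time M w)) = (if w \<in> L then accept M else reject M)" for w
  proof -
    obtain k where k: "k \<le> t w"
      "fst (tm_run M w k) = (if w \<in> L then accept M else reject M)"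
      using r[of w] unfolding reaches_def tm_run_def by auto
    then have h: "tm_halted M w k" by (simp add: tm_halted_def)
    then have h': "tm_halted M w (tm_time M w)" and le: "tm_time M w \<le> k"
      unfolding tm_time_def by (auto intro: LeastI Least_le)
    \<comment> \<open>Halted configurations are fixed by the step map, so the verdict found at time
      k already stands at the least halting time.\<close>
    have "tm_run M w (tm_time M w + j) = tm_run M w (tm_time M w)" for j
    proof (induction j)
      case (Suc j)
      then show ?case using h'
        by (auto simp: tm_run_def tm_halted_def tm_step_def split: prod.splits)
    qed simp
    from this[of "k - tm_time M w"] show ?thesis using h' le k by simp
  qed
  show "tm_decides M L"
    using main M by (auto simp: tm_decides_def wf_tm_def)
  show "tm_time M w \<le> t w" using main by blast
qed

section \<open>Transducers with rejection, and tape contents\<close>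

fun trun :: "('q \<Rightarrow> nat \<Rightarrow> ('q \<times> nat list) option) \<Rightarrow> 'q \<Rightarrow> nat list \<Rightarrow> nat list option" where
  "trun \<delta> q [] = Some []"
| "trun \<delta> q (a # c) = (case \<delta> q a of None \<Rightarrow> None
     | Some (q', ys) \<Rightarrow> map_option ((@) ys) (trun \<delta> q' c))"

text \<open>One round: a pass over the same content from each start state, with concatenated
  outputs. The last end marker \<open>1\<close> is not stored; the machine supplies it on reaching
  the blank, so an input without any marker is a legitimate content.\<close>

fun level :: "('q \<Rightarrow> nat \<Rightarrow> ('q \<times> nat list) option) \<Rightarrow> 'q list \<Rightarrow> nat list \<Rightarrow> nat list option" where
  "level \<delta> [] c = Some []"
| "level \<delta> (q # qs) c = (case trun \<delta> q (c @ [1]) of None \<Rightarrow> None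
     | Some ys \<Rightarrow> map_option ((@) ys) (level \<delta> qs c))"

text \<open>A tape whose content is read towards the left: \<open>c ! i\<close> sits at position \<open>r - i\<close>.\<close>

definition tape :: "int \<Rightarrow> nat list \<Rightarrow> int \<Rightarrow> nat" where
  "tape r c p = (if p \<le> r \<and> nat (r - p) < length c then c ! nat (r - p) else 0)"

lemma tape_Nil [simp]: "tape r [] = (\<lambda>_. 0)"
  by (auto simp: tape_def)

lemma tape_snoc: "(tape r c)(r - int (length c) := y) = tape r (c @ [y])"
  by (auto simp: tape_def fun_eq_iff nth_append)

lemma tape_nth: "i < length c \<Longrightarrow> tape r c (r - int i) = c ! i"
  by (simp add: tape_def)

lemma tape_left_end: "tape r c (r - int (length c)) = 0"
  by (simp add: tape_def)

lemma tape_right_end: "tape r c (r + 1) = 0"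
  by (simp add: tape_def)

lemma tape_nonblank:
  assumes "r - int (length c) < p" "p \<le> r" "0 \<notin> set c" shows "tape r c p \<noteq> 0"
proof -
  have "nat (r - p) < length c" using assms by linarith
  then have "c ! nat (r - p) \<in> set c" by (rule nth_mem)
  then have "c ! nat (r - p) \<noteq> 0" using assms(3) by metis
  then show ?thesis using assms \<open>nat (r - p) < length c\<close> by (simp add: tape_def)
qed

text \<open>\<open>Chk\<close> tests for an empty tape, \<open>Rew\<close> runs back to the right
  end, \<open>Pas\<close> is a pass and \<open>Fin\<close> its end. The list over 'q holds the start
  states of later passes, the list of numbers the output still to be written.\<close>

datatype 'q ctl = Chk | Rew 'q "'q list" | Pas 'q "'q list" "nat list" | Fin "'q list" "nat list"
  | Acc | Rej

instance ctl :: (countable) countable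
  by countable_datatype

text \<open>The flag tells which tape currently serves as input. The halting states are coded
  without it, as the machine has a single accepting and a single rejecting state.\<close>

definition ctl_code :: "bool \<Rightarrow> 'q::countable ctl \<Rightarrow> nat" where
  "ctl_code b c = (case c of Acc \<Rightarrow> 0 | Rej \<Rightarrow> 1 | _ \<Rightarrow> 2 + to_nat (b, c))"

abbreviation ordered :: "bool \<Rightarrow> 'a \<Rightarrow> 'a \<Rightarrow> 'a list" where
  "ordered b x y \<equiv> (if b then [y, x] else [x, y])"

section \<open>The simulating machine\<close>

locale iterated_transducer =
  fixes \<delta> :: "'q::countable \<Rightarrow> nat \<Rightarrow> ('q \<times> nat list) option"
    and Q :: "'q set" and q0 :: 'q and qs0 :: "'q list"
    and Sy :: "nat set" and en :: "'s \<Rightarrow> nat"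
  assumes finQ: "finite Q" and start_states: "set (q0 # qs0) \<subseteq> Q"
    and finSy: "finite Sy" and Sy01: "0 \<notin> Sy" "1 \<in> Sy"
    and en: "inj en" "range en \<subseteq> Sy"
    and \<delta>: "\<And>q a q' ys. q \<in> Q \<Longrightarrow> a \<in> Sy \<Longrightarrow> \<delta> q a = Some (q', ys) \<Longrightarrow>
       q' \<in> Q \<and> set ys \<subseteq> Sy \<and> length ys \<le> 2"
begin

text \<open>Given the control state and the symbols read on the input and the output tape: the new
control state, whether the two tapes swap roles, the symbols written, and the head moves.\<close>

fun ctl_step :: "'q ctl \<Rightarrow> nat \<Rightarrow> nat \<Rightarrow> 'q ctl \<times> bool \<times> nat \<times> nat \<times> int \<times> int" where
  "ctl_step Chk a z = (if a = 0 then Acc else Rew q0 qs0, False, a, z, 0, 0)"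
| "ctl_step (Rew q qs) a z = (if a = 0 then (Pas q qs [], False, a, z, -1, 0)
      else (Rew q qs, False, a, z, 1, 0))"
| "ctl_step (Pas q qs (y # ys)) a z = (Pas q qs ys, False, a, y, 0, -1)"
| "ctl_step (Pas q qs []) a z = (if a = 0 then
        (case \<delta> q 1 of None \<Rightarrow> (Rej, False, a, z, 0, 0) | Some (q', ys) \<Rightarrow> (Fin qs ys, False, a, z, 0, 0))
      else
        (case \<delta> q a of None \<Rightarrow> (Rej, False, a, z, 0, 0)
         | Some (q', ys) \<Rightarrow> (Pas q' qs ys, False, if qs = [] then 0 else a, z, -1, 0)))"
| "ctl_step (Fin qs (y # ys)) a z = (Fin qs ys, False, a, y, 0, -1)"
| "ctl_step (Fin [] []) a z = (Chk, True, a, z, 0, 1)"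
| "ctl_step (Fin (q # qs) []) a z = (Rew q qs, False, a, z, 1, 0)"
| "ctl_step Acc a z = (Acc, False, a, z, 0, 0)"
| "ctl_step Rej a z = (Rej, False, a, z, 0, 0)"

text \<open>Cuts the infinite type of control states down to a finite set closed under
  \<open>ctl_step\<close>.\<close>

fun valid :: "'q ctl \<Rightarrow> bool" where
  "valid (Rew q qs) = (set (q # qs) \<subseteq> Q \<and> length qs \<le> length qs0)"
| "valid (Pas q qs ys) = (set (q # qs) \<subseteq> Q \<and> length qs \<le> length qs0 \<and> set ys \<subseteq> Sy \<and> length ys \<le> 2)"
| "valid (Fin qs ys) = (set qs \<subseteq> Q \<and> length qs \<le> length qs0 \<and> set ys \<subseteq> Sy \<and> length ys \<le> 2)"
| "valid _ = True"

definition machine :: "'s tm" where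
  "machine = \<lparr> ntapes = 2, states = (\<lambda>(b, c). ctl_code b c) ` (UNIV \<times> {c. valid c}),
     symbols = insert 0 Sy, enc = en, start = ctl_code False (Chk :: 'q ctl),
     accept = 0, reject = 1,
     delta = (\<lambda>n gs. if n < 2 then (n, gs, [0, 0]) else
        (let (b, c) = from_nat (n - 2) in
         case ctl_step c (gs ! (if b then 1 else 0)) (gs ! (if b then 0 else 1)) of
           (c', sw, wi, wo, mi, mo) \<Rightarrow> (ctl_code (b \<noteq> sw) c', ordered b wi wo, ordered b mi mo))) \<rparr>"

lemma finite_valid: "finite {c. valid c}"
proof -
  let ?L = "{qs. set qs \<subseteq> Q \<and> length qs \<le> length qs0}"
  let ?B = "{ys. set ys \<subseteq> Sy \<and> length ys \<le> 2}"
  have "{c. valid c} \<subseteq> {Chk, Acc, Rej} \<union> (\<lambda>(q, qs). Rew q qs) ` (Q \<times> ?L)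
      \<union> (\<lambda>(q, qs, ys). Pas q qs ys) ` (Q \<times> ?L \<times> ?B) \<union> (\<lambda>(qs, ys). Fin qs ys) ` (?L \<times> ?B)"
  proof
    fix c assume "c \<in> {c. valid c}"
    then show "c \<in> {Chk, Acc, Rej} \<union> (\<lambda>(q, qs). Rew q qs) ` (Q \<times> ?L)
      \<union> (\<lambda>(q, qs, ys). Pas q qs ys) ` (Q \<times> ?L \<times> ?B) \<union> (\<lambda>(qs, ys). Fin qs ys) ` (?L \<times> ?B)"
      by (cases c) (auto simp: image_iff)
  qed
  moreover have "finite ?L" "finite ?B"
    by (simp_all add: finite_lists_length_le finQ finSy)
  ultimately show ?thesis
    using finQ by (auto intro: finite_subset)
qed

lemma valid_step:
  assumes "valid c" "a \<in> insert 0 Sy" "z \<in> insert 0 Sy"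
    and "ctl_step c a z = (c', sw, wi, wo, mi, mo)"
  shows "valid c' \<and> {wi, wo} \<subseteq> insert 0 Sy \<and> {mi, mo} \<subseteq> {-1, 0, 1}"
  using assms start_states Sy01
  by (cases "(c, a, z)" rule: ctl_step.cases)
    (auto split: if_splits option.splits dest: \<delta>)

lemma wf_machine: "wf_tm machine"
proof -
  have code: "ctl_code b c \<in> states machine" if "valid c" for b c
    using that by (force simp: machine_def)
  have delta: "case delta machine n gs of (q', ws, ms) \<Rightarrow>
       q' \<in> states machine \<and> length ws = ntapes machine \<and> set ws \<subseteq> symbols machine \<and>
           length ms = ntapes machine \<and> set ms \<subseteq> {-1, 0, 1}"
    if n: "n \<in> states machine" and gs: "length gs = ntapes machine" "set gs \<subseteq> symbols machine" for n gs
  proof -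
    obtain b c where bc: "n = ctl_code b c" "valid c" using n by (auto simp: machine_def)
    obtain x y where xy: "gs = [x, y]" "{x, y} \<subseteq> insert 0 Sy"
      using gs by (auto simp: machine_def length_Suc_conv numeral_2_eq_2)
    show ?thesis
    proof (cases "n < 2")
      case True
      then show ?thesis using n xy by (simp add: machine_def)
    next
      case False
      then have n2: "n - 2 = to_nat (b, c)" using bc by (simp add: ctl_code_def split: ctl.splits)
      obtain c' sw wi wo mi mo where
        cs: "ctl_step c (gs ! (if b then 1 else 0)) (gs ! (if b then 0 else 1)) = (c', sw, wi, wo, mi, mo)"
        by (metis prod_cases6)
      then have "valid c' \<and> {wi, wo} \<subseteq> insert 0 Sy \<and> {mi, mo} \<subseteq> {-1, 0, 1}"
        using bc xy by (intro valid_step[OF _ _ _ cs]) auto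
      then show ?thesis using code[of c'] False cs n2 by (simp add: machine_def)
    qed
  qed
  have "finite (states machine)"
    by (simp add: machine_def finite_valid)
  moreover have "0 = ctl_code False (Acc :: 'q ctl)" "1 = ctl_code False (Rej :: 'q ctl)"
    by (simp_all add: ctl_code_def)
  then have "0 \<in> states machine" "1 \<in> states machine" "ctl_code False (Chk :: 'q ctl) \<in> states machine"
    using code valid.simps by metis+
  ultimately show ?thesis
    unfolding wf_tm_def using delta finSy en Sy01 by (auto simp: machine_def)
qed

definition conf :: "bool \<Rightarrow> 'q ctl \<Rightarrow> (int \<Rightarrow> nat) \<Rightarrow> int \<Rightarrow> (int \<Rightarrow> nat) \<Rightarrow> int \<Rightarrow> config" where
  "conf b c ti hi to ho = (ctl_code b c, ordered b ti to, ordered b hi ho)"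

lemma machine_step:
  assumes c: "c \<noteq> Acc" "c \<noteq> Rej"
  shows "tm_step machine (conf b c ti hi to ho) =
    (case ctl_step c (ti hi) (to ho) of (c', sw, wi, wo, mi, mo) \<Rightarrow>
     if sw then conf (\<not> b) c' (to(ho := wo)) (ho + mo) (ti(hi := wi)) (hi + mi)
     else conf b c' (ti(hi := wi)) (hi + mi) (to(ho := wo)) (ho + mo))"
proof -
  obtain c' sw wi wo mi mo where s: "ctl_step c (ti hi) (to ho) = (c', sw, wi, wo, mi, mo)"
    by (metis prod_cases6)
  have n: "ctl_code b c = 2 + to_nat (b, c)" for b
    using c by (cases c) (simp_all add: ctl_code_def)
  have "[0..<2] = [0, 1::nat]" by (simp add: numeral_2_eq_2)
  then show ?thesis
    using s by (cases b; cases sw) (simp_all add: tm_step_def conf_def machine_def n)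
qed

section \<open>Running times of a pass, a round and the whole computation\<close>

abbreviation "rejects n x \<equiv> \<exists>y. reaches machine n x y \<and> fst y = 1"

lemma rejects_after: "reaches machine n x y \<Longrightarrow> rejects m y \<Longrightarrow> n + m \<le> k \<Longrightarrow> rejects k x"
  using reaches_mono reaches_trans by blast

lemma rejects_step:
  assumes "tm_step machine x = conf b Rej ti hi to ho" "0 < n" shows "rejects n x"
proof (intro exI conjI)
  show "reaches machine n x (conf b Rej ti hi to ho)"
    by (rule reaches_mono[OF reaches_step[OF assms(1) reaches_refl[of _ 0]]]) (use assms(2) in simp)
qed (simp add: conf_def ctl_code_def)

lemma flush_Pas:
  "reaches machine (length ys) (conf b (Pas q qs ys) ti h (tape r z) (r - int (length z)))
     (conf b (Pas q qs []) ti h (tape r (z @ ys)) (r - int (length (z @ ys))))"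
proof (induction ys arbitrary: z)
  case (Cons y ys)
  have "tm_step machine (conf b (Pas q qs (y # ys)) ti h (tape r z) (r - int (length z))) =
      conf b (Pas q qs ys) ti h (tape r (z @ [y])) (r - int (length (z @ [y])))"
    by (auto simp: machine_step tape_snoc algebra_simps)
  from reaches_step[OF this Cons.IH] show ?case by simp
qed simp

lemma flush_Fin:
  "reaches machine (length ys) (conf b (Fin qs ys) ti h (tape r z) (r - int (length z)))
     (conf b (Fin qs []) ti h (tape r (z @ ys)) (r - int (length (z @ ys))))"
proof (induction ys arbitrary: z)
  case (Cons y ys)
  have "tm_step machine (conf b (Fin qs (y # ys)) ti h (tape r z) (r - int (length z))) =
      conf b (Fin qs ys) ti h (tape r (z @ [y])) (r - int (length (z @ [y])))"
    by (auto simp: machine_step tape_snoc algebra_simps)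
  from reaches_step[OF this Cons.IH] show ?case by simp
qed simp

text \<open>Each symbol, the implicit end marker included, costs one step to read and at most two to
  write. If \<open>qs = []\<close>, the pass is the last over this tape and blanks it on the way, so
  that it can receive the output of the next round.\<close>

lemma pass:
  assumes "q \<in> Q" "set c \<subseteq> Sy"
    and "\<And>i. i < length c \<Longrightarrow> ti (h - int i) = c ! i" "ti (h - int (length c)) = 0"
  shows "case trun \<delta> q (c @ [1]) of
      None \<Rightarrow> rejects (3 * (length c + 1)) (conf b (Pas q qs []) ti h (tape r z) (r - int (length z)))
    | Some ys \<Rightarrow> reaches machine (3 * (length c + 1))
        (conf b (Pas q qs []) ti h (tape r z) (r - int (length z)))
        (conf b (Fin qs []) (if qs = [] then \<lambda>p. if h - int (length c) < p \<and> p \<le> h then 0 else ti p else ti)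
          (h - int (length c)) (tape r (z @ ys)) (r - int (length (z @ ys))))"
  using assms
proof (induction c arbitrary: q ti h z)
  case Nil
  have ti: "(\<lambda>p. if h < p \<and> p \<le> h then 0 else ti p) = ti" by auto
  show ?case
  proof (cases "\<delta> q 1")
    case None
    have "tm_step machine (conf b (Pas q qs []) ti h (tape r z) (r - int (length z))) =
        conf b Rej ti h (tape r z) (r - int (length z))"
      using Nil None by (auto simp: machine_step fun_upd_idem)
    then have "rejects n (conf b (Pas q qs []) ti h (tape r z) (r - int (length z)))" if "0 < n" for n
      using that by (rule rejects_step)
    then show ?thesis using None by simp
  next
    case (Some p)
    obtain q' ys where p: "p = (q', ys)" by (cases p)
    have ys: "length ys \<le> 2" using \<delta>[of q 1 q' ys] Some p Nil Sy01 by auto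
    have "tm_step machine (conf b (Pas q qs []) ti h (tape r z) (r - int (length z))) =
        conf b (Fin qs ys) ti h (tape r z) (r - int (length z))"
      using Nil Some p by (auto simp: machine_step fun_upd_idem)
    from reaches_step[OF this flush_Fin] show ?thesis
      using Some p ys by (auto simp: ti intro: reaches_mono)
  qed
next
  case (Cons a c)
  have a: "a \<in> Sy" and c: "set c \<subseteq> Sy" using Cons.prems(2) by auto
  then have "a \<noteq> 0" using Sy01 by metis
  note a = a this
  have ti: "ti h = a" using Cons.prems(3)[of 0] by simp
  show ?case
  proof (cases "\<delta> q a")
    case None
    have "tm_step machine (conf b (Pas q qs []) ti h (tape r z) (r - int (length z))) =
        conf b Rej ti h (tape r z) (r - int (length z))"
      using None ti a by (auto simp: machine_step fun_upd_idem)
    then have "rejects n (conf b (Pas q qs []) ti h (tape r z) (r - int (length z)))" if "0 < n" for n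
      using that by (rule rejects_step)
    then show ?thesis using None by simp
  next
    case (Some p)
    obtain q' ys where p: "p = (q', ys)" by (cases p)
    have ys: "length ys \<le> 2" and q': "q' \<in> Q" using \<delta>[of q a q' ys] Some p Cons.prems a by auto
    define ti' where "ti' = ti(h := if qs = [] then 0 else a)"
    have "tm_step machine (conf b (Pas q qs []) ti h (tape r z) (r - int (length z))) =
        conf b (Pas q' qs ys) ti' (h - 1) (tape r z) (r - int (length z))"
      using Some p ti a by (auto simp: machine_step fun_upd_idem ti'_def)
    from reaches_step[OF this flush_Pas]
    have 1: "reaches machine 3 (conf b (Pas q qs []) ti h (tape r z) (r - int (length z)))
        (conf b (Pas q' qs []) ti' (h - 1) (tape r (z @ ys)) (r - int (length (z @ ys))))"
      by (rule reaches_mono) (use ys in simp)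
    have 2: "ti' (h - 1 - int i) = c ! i" if "i < length c" for i
      using Cons.prems(3)[of "Suc i"] that by (simp add: ti'_def algebra_simps)
    have 3: "ti' (h - 1 - int (length c)) = 0"
      using Cons.prems(4) by (simp add: ti'_def algebra_simps)
    have 4: "(if qs = [] then \<lambda>p. if h - 1 - int (length c) < p \<and> p \<le> h - 1 then 0 else ti' p else ti') =
       (if qs = [] then \<lambda>p. if h - int (length (a # c)) < p \<and> p \<le> h then 0 else ti p else ti)"
      using ti by (auto simp: ti'_def fun_eq_iff)
    have 5: "h - 1 - int (length c) = h - int (length (a # c))" by simp
    have 6: "3 * (length (a # c) + 1) = 3 + 3 * (length c + 1)" by simp
    note IH = Cons.IH[OF q' c 2 3, of "z @ ys", unfolded 4, unfolded 5]
    show ?thesis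
    proof (cases "trun \<delta> q' (c @ [1])")
      case None
      with IH rejects_after[OF 1, of "3 * (length c + 1)"] show ?thesis
        using Some p unfolding 6 by simp
    next
      case s: (Some zs)
      then have "reaches machine (3 * (length c + 1))
        (conf b (Pas q' qs []) ti' (h - 1) (tape r (z @ ys)) (r - int (length (z @ ys))))
        (conf b (Fin qs []) (if qs = [] then \<lambda>p. if h - int (length (a # c)) < p \<and> p \<le> h then 0 else ti p else ti)
          (h - int (length (a # c))) (tape r (z @ ys @ zs)) (r - int (length (z @ ys @ zs))))"
        using IH by simp
      from reaches_trans[OF 1 this] show ?thesis
        using Some p s unfolding 6 by simp
    qed
  qed
qed

text \<open>Induction on the distance of the head to the blank at \<open>r + 1\<close>, where the
  machine turns; the extra step is that turn.\<close>

lemma rewind: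
  assumes "r - int (length c) < hi" "hi \<le> r + 1" "0 \<notin> set c"
  shows "reaches machine (length c + 1) (conf b (Rew q qs) (tape r c) hi to ho)
    (conf b (Pas q qs []) (tape r c) r to ho)"
proof -
  have "reaches machine (n + 1) (conf b (Rew q qs) (tape r c) (r + 1 - int n) to ho)
    (conf b (Pas q qs []) (tape r c) r to ho)" if "n \<le> length c" for n
    using that
  proof (induction n)
    case 0
    have "tm_step machine (conf b (Rew q qs) (tape r c) (r + 1) to ho) = conf b (Pas q qs []) (tape r c) r to ho"
      by (auto simp: machine_step fun_upd_idem tape_right_end)
    then show ?case using reaches_step[OF _ reaches_refl[of _ 0]] by fastforce
  next
    case (Suc n)
    have "tape r c (r + 1 - int (Suc n)) \<noteq> 0"
      using Suc.prems assms(3) by (intro tape_nonblank) auto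
    then have "tm_step machine (conf b (Rew q qs) (tape r c) (r + 1 - int (Suc n)) to ho) =
        conf b (Rew q qs) (tape r c) (r + 1 - int n) to ho"
      by (auto simp: machine_step fun_upd_idem algebra_simps)
    from reaches_step[OF this] Suc show ?case by simp
  qed
  from this[of "nat (r + 1 - hi)"] have
    "reaches machine (nat (r + 1 - hi) + 1) (conf b (Rew q qs) (tape r c) hi to ho)
      (conf b (Pas q qs []) (tape r c) r to ho)"
    using assms by simp
  then show ?thesis by (rule reaches_mono) (use assms in simp)
qed

text \<open>A pass needs \<open>length c + 1\<close> steps to rewind,
  \<open>3 * (length c + 1)\<close> to read and write, and one to leave. The word z is the output of
  earlier passes. After the swap the head stands on the last symbol written or, if there is none, on
  a blank.\<close>

lemma level_run:
  assumes "set (q # qs) \<subseteq> Q" "r - int (length c) < hi" "hi \<le> r + 1" "set c \<subseteq> Sy"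
  shows "case level \<delta> (q # qs) c of
      None \<Rightarrow> rejects ((length qs + 1) * (4 * length c + 5))
        (conf b (Rew q qs) (tape r c) hi (tape r' z) (r' - int (length z)))
    | Some ys \<Rightarrow> reaches machine ((length qs + 1) * (4 * length c + 5))
        (conf b (Rew q qs) (tape r c) hi (tape r' z) (r' - int (length z)))
        (conf (\<not> b) Chk (tape r' (z @ ys)) (r' - int (length (z @ ys)) + 1) (\<lambda>_. 0) (r - int (length c)))"
  using assms
proof (induction qs arbitrary: q hi z)
  case Nil
  have n0: "0 \<notin> set c" using Nil Sy01 by auto
  have 1: "reaches machine (length c + 1) (conf b (Rew q []) (tape r c) hi (tape r' z) (r' - int (length z)))
      (conf b (Pas q [] []) (tape r c) r (tape r' z) (r' - int (length z)))"
    by (rule rewind) (use Nil n0 in auto)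
  have 2: "(\<lambda>p. if r - int (length c) < p \<and> p \<le> r then 0 else tape r c p) = (\<lambda>_. 0)"
    by (auto simp: tape_def fun_eq_iff)
  note P = pass[of q c "tape r c" r b "[]" r' z, unfolded 2 if_P[OF refl]]
  show ?case
  proof (cases "trun \<delta> q (c @ [1])")
    case None
    with P Nil rejects_after[OF 1, of "3 * (length c + 1)"] show ?thesis
      by (simp add: tape_nth tape_left_end)
  next
    case (Some ys)
    let ?F = "conf b (Fin [] []) (\<lambda>_. 0) (r - int (length c)) (tape r' (z @ ys)) (r' - int (length (z @ ys)))"
    have 3: "reaches machine (3 * (length c + 1))
       (conf b (Pas q [] []) (tape r c) r (tape r' z) (r' - int (length z))) ?F"
      using P Some Nil by (simp add: tape_nth tape_left_end)
    have "tm_step machine ?F = conf (\<not> b) Chk (tape r' (z @ ys)) (r' - int (length (z @ ys)) + 1)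
       (\<lambda>_. 0) (r - int (length c))"
      by (auto simp: machine_step fun_upd_idem)
    from reaches_trans[OF reaches_trans[OF 1 3] reaches_step[OF this reaches_refl[of _ 0]]]
    show ?thesis using Some by (auto elim: reaches_mono)
  qed
next
  case (Cons q2 qs)
  have n0: "0 \<notin> set c" using Cons.prems Sy01 by auto
  have 1: "reaches machine (length c + 1) (conf b (Rew q (q2 # qs)) (tape r c) hi (tape r' z) (r' - int (length z)))
      (conf b (Pas q (q2 # qs) []) (tape r c) r (tape r' z) (r' - int (length z)))"
    by (rule rewind) (use Cons.prems n0 in auto)
  note P = pass[of q c "tape r c" r b "q2 # qs" r' z]
  have T: "(length (q2 # qs) + 1) * (4 * length c + 5) = (4 * length c + 5) + (length qs + 1) * (4 * length c + 5)"
    by simp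
  show ?case
  proof (cases "trun \<delta> q (c @ [1])")
    case None
    with P Cons.prems rejects_after[OF 1, of "3 * (length c + 1)"] show ?thesis
      unfolding T by (simp add: tape_nth tape_left_end)
  next
    case (Some ys)
    let ?F = "conf b (Fin (q2 # qs) []) (tape r c) (r - int (length c)) (tape r' (z @ ys)) (r' - int (length (z @ ys)))"
    let ?R = "conf b (Rew q2 qs) (tape r c) (r - int (length c) + 1) (tape r' (z @ ys)) (r' - int (length (z @ ys)))"
    have 3: "reaches machine (3 * (length c + 1))
       (conf b (Pas q (q2 # qs) []) (tape r c) r (tape r' z) (r' - int (length z))) ?F"
      using P Some Cons.prems by (simp add: tape_nth tape_left_end)
    have "tm_step machine ?F = ?R"
      by (auto simp: machine_step fun_upd_idem)
    from reaches_trans[OF reaches_trans[OF 1 3] reaches_step[OF this reaches_refl[of _ 0]]]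
    have 4: "reaches machine (4 * length c + 5)
        (conf b (Rew q (q2 # qs)) (tape r c) hi (tape r' z) (r' - int (length z))) ?R"
      by (rule reaches_mono) simp
    have IH: "case level \<delta> (q2 # qs) c of
      None \<Rightarrow> rejects ((length qs + 1) * (4 * length c + 5)) ?R
    | Some zs \<Rightarrow> reaches machine ((length qs + 1) * (4 * length c + 5)) ?R
        (conf (\<not> b) Chk (tape r' ((z @ ys) @ zs)) (r' - int (length ((z @ ys) @ zs)) + 1) (\<lambda>_. 0) (r - int (length c)))"
      by (rule Cons.IH) (use Cons.prems in auto)
    have lev: "level \<delta> (q # q2 # qs) c = map_option ((@) ys) (level \<delta> (q2 # qs) c)"
      using Some by simp
    show ?thesis
    proof (cases "level \<delta> (q2 # qs) c")
      case None
      with IH rejects_after[OF 4] show ?thesis unfolding T lev by auto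
    next
      case (Some zs)
      then have "reaches machine ((length qs + 1) * (4 * length c + 5)) ?R
          (conf (\<not> b) Chk (tape r' (z @ ys @ zs)) (r' - int (length (z @ ys @ zs)) + 1) (\<lambda>_. 0)
            (r - int (length c)))"
        using IH by (simp del: level.simps)
      from reaches_trans[OF 4 this] Some show ?thesis
        unfolding T lev by (simp del: level.simps)
    qed
  qed
qed

text \<open>The index k is fuel: each successful round on a nonempty tape consumes one unit, so at
  most k such rounds occur. The truth value t is the answer, preserved by the rounds; the additional
  1 per round pays for \<open>Chk\<close>.\<close>

lemma iterate_run:
  assumes Sy: "\<And>k c. Inv k c \<Longrightarrow> set c \<subseteq> Sy" and len: "\<And>k c. Inv k c \<Longrightarrow> length c \<le> B"
    and down: "\<And>k c c'. Inv k c \<Longrightarrow> c \<noteq> [] \<Longrightarrow> level \<delta> (q0 # qs0) c = Some c' \<Longrightarrow>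
        \<exists>k'. k = Suc k' \<and> Inv k' c'"
    and rej: "\<And>k c. Inv k c \<Longrightarrow> level \<delta> (q0 # qs0) c = None \<Longrightarrow> \<not> t"
    and acc: "\<And>k. Inv k [] \<Longrightarrow> t"
  shows "Inv k c \<Longrightarrow> \<exists>y. reaches machine ((k + 1) * (length (q0 # qs0) * (4 * B + 5) + 1))
     (conf b Chk (tape r c) (r - int (length c) + 1) (\<lambda>_. 0) h) y \<and> fst y = (if t then 0 else 1)"
proof (induction k arbitrary: b r c h rule: less_induct)
  case (less k)
  let ?D = "length (q0 # qs0) * (4 * B + 5) + 1"
  let ?X = "conf b Chk (tape r c) (r - int (length c) + 1) (\<lambda>_. 0) h"
  show ?case
  proof (cases "c = []")
    case True
    have "tm_step machine ?X = conf b Acc (tape r c) (r - int (length c) + 1) (\<lambda>_. 0) h"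
      using True by (auto simp: machine_step fun_upd_idem)
    from reaches_step[OF this reaches_refl[of _ 0]] show ?thesis
      using True acc less.prems
      by (intro exI[of _ "conf b Acc (tape r c) (r - int (length c) + 1) (\<lambda>_. 0) h"])
        (auto simp: conf_def ctl_code_def elim!: reaches_mono)
  next
    case False
    let ?R = "conf b (Rew q0 qs0) (tape r c) (r - int (length c) + 1) (tape h []) (h - int (length ([] :: nat list)))"
    have S: "set c \<subseteq> Sy" using Sy less.prems by blast
    have "tape r c (r - int (length c) + 1) \<noteq> 0"
      using False S Sy01 by (intro tape_nonblank) (auto simp: Suc_leI)
    then have 1: "tm_step machine ?X = ?R"
      by (auto simp: machine_step fun_upd_idem)
    have lv: "case level \<delta> (q0 # qs0) c of
      None \<Rightarrow> rejects ((length qs0 + 1) * (4 * length c + 5)) ?R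
    | Some ys \<Rightarrow> reaches machine ((length qs0 + 1) * (4 * length c + 5)) ?R
        (conf (\<not> b) Chk (tape h ([] @ ys)) (h - int (length ([] @ ys)) + 1) (\<lambda>_. 0) (r - int (length c)))"
      by (rule level_run) (use start_states S in auto)
    have D: "Suc ((length qs0 + 1) * (4 * length c + 5)) \<le> ?D"
      using mult_le_mono2[of "4 * length c + 5" "4 * B + 5" "length qs0 + 1"] len[OF less.prems]
      by simp
    show ?thesis
    proof (cases "level \<delta> (q0 # qs0) c")
      case None
      then obtain y where y: "reaches machine ((length qs0 + 1) * (4 * length c + 5)) ?R y" "fst y = 1"
        using lv by auto
      have "reaches machine ((k + 1) * ?D) ?X y"
        by (rule reaches_mono[OF reaches_step[OF 1 y(1)]]) (use D in simp)
      then show ?thesis using y rej[OF less.prems None] by (intro exI[of _ y] conjI) simp_all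
    next
      case (Some c')
      then obtain k' where k': "k = Suc k'" "Inv k' c'"
        using down[OF less.prems False] by blast
      let ?Y = "conf (\<not> b) Chk (tape h c') (h - int (length c') + 1) (\<lambda>_. 0) (r - int (length c))"
      have a: "reaches machine ?D ?X ?Y"
        by (rule reaches_mono[OF reaches_step[OF 1] D]) (use lv Some in simp)
      obtain y where y: "reaches machine ((k' + 1) * ?D) ?Y y" "fst y = (if t then 0 else 1)"
        using less.IH[of k' c' "\<not> b" h "r - int (length c)"] k' by blast
      have "reaches machine ((k + 1) * ?D) ?X y"
        by (rule reaches_mono[OF reaches_trans[OF a y(1)]]) (simp add: k')
      then show ?thesis using y(2) by (intro exI[of _ y] conjI)
    qed
  qed
qed

text \<open>Read towards the left from its last cell the input is reversed, and cell 0, where the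
  head starts, is the left end of the content, as \<open>Chk\<close> expects.\<close>

lemma machine_init:
  "tm_init machine w =
    conf False Chk (tape (int (length w) - 1) (rev (map en w)))
      (int (length w) - 1 - int (length (rev (map en w))) + 1) (\<lambda>_. 0) 0"
proof -
  have "(\<lambda>i. if 0 \<le> i \<and> nat i < length w then en (w ! nat i) else 0) =
      tape (int (length w) - 1) (rev (map en w))"
  proof
    fix i :: int
    show "(if 0 \<le> i \<and> nat i < length w then en (w ! nat i) else 0) =
      tape (int (length w) - 1) (rev (map en w)) i"
    proof (cases "0 \<le> i \<and> nat i < length w")
      case True
      then have "length w - Suc (nat (int (length w) - 1 - i)) = nat i" by linarith
      then show ?thesis using True by (auto simp: tape_def rev_nth)
    qed (auto simp: tape_def)
  qed
  note t = this
  have e: "enc machine = en" "ntapes machine = 2" "start machine = ctl_code False (Chk :: 'q ctl)"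
    by (simp_all add: machine_def)
  show ?thesis unfolding tm_init_def e t by (simp add: conf_def numeral_2_eq_2)
qed

end

section \<open>Halving words over a contracting set\<close>

text \<open>The first letter of the list acts first, so that images of vertices can be followed in
  reading order.\<close>

fun prodw :: "('b \<Rightarrow> 'b) list \<Rightarrow> 'b \<Rightarrow> 'b" where
  "prodw [] = id"
| "prodw (g # w) = prodw w \<circ> g"

lemma prodw_append: "prodw (w @ w') = prodw w' \<circ> prodw w"
  by (induction w) (auto simp: fun_eq_iff)

lemma tree_aut_prodw: "\<forall>g\<in>set w. tree_aut g \<Longrightarrow> tree_aut (prodw w)"
  by (induction w) (auto intro!: tree_aut_comp)

definition nontriv :: "('b \<Rightarrow> 'b) \<Rightarrow> ('b \<Rightarrow> 'b) list" where
  "nontriv g = (if g = id then [] else [g])"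

text \<open>The section at \<open>u\<close> of a word, multiplied out in pairs and without trivial letters.\<close>

fun halve :: "'x list \<Rightarrow> ('x list \<Rightarrow> 'x list) list \<Rightarrow> ('x list \<Rightarrow> 'x list) list" where
  "halve u [] = []"
| "halve u [g] = nontriv (sec g u)"
| "halve u (g # h # w) = nontriv (sec (h \<circ> g) u) @ halve ((h \<circ> g) u) w"

lemma prodw_nontriv [simp]: "prodw (nontriv g) = g"
  by (simp add: nontriv_def)

lemma length_nontriv_le: "length (nontriv g) \<le> 1"
  by (simp add: nontriv_def)

lemma prodw_halve:
  "\<forall>g\<in>set w. tree_aut g \<Longrightarrow> prodw (halve u w) = sec (prodw w) u"
proof (induction u w rule: halve.induct)
  case (3 u g h w)
  have t: "tree_aut (prodw w)" "tree_aut (h \<circ> g)"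
    using 3 by (auto intro!: tree_aut_prodw tree_aut_comp)
  have "prodw (g # h # w) = prodw w \<circ> (h \<circ> g)" by (simp add: comp_assoc)
  then show ?case using 3 by (simp only: sec_comp[OF t] halve.simps prodw_append prodw_nontriv) simp
qed simp_all

lemma length_halve: "2 * length (halve u w) \<le> length w + 1"
proof (induction u w rule: halve.induct)
  case (2 u g)
  then show ?case using length_nontriv_le[of "sec g u"] by simp
next
  case (3 u g h w)
  then show ?case using length_nontriv_le[of "sec (h \<circ> g) u"] by simp
qed simp

lemma halve_nontrivial: "g \<in> set (halve u w) \<Longrightarrow> g \<noteq> id"
  by (induction u w rule: halve.induct) (auto simp: nontriv_def split: if_splits)

text \<open>At depth 0 this counts the nontrivial letters; greater depths predict how many will
  remain in later rounds.\<close>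

definition pot :: "nat \<Rightarrow> ('x list \<Rightarrow> 'x list) list \<Rightarrow> nat" where
  "pot j w = (\<Sum>g\<leftarrow>w. act j g)"

lemma pot_simps [simp]: "pot j [] = 0" "pot j (g # w) = act j g + pot j w"
  "pot j (w @ w') = pot j w + pot j w'"
  by (simp_all add: pot_def)

lemma pot_nontriv [simp]: "pot j (nontriv g) = act j g"
  by (simp add: nontriv_def act_def)

lemma length_halve_pot: "length (halve u w) = pot 0 (halve u w)"
proof -
  have "\<forall>g\<in>set v. g \<noteq> id \<Longrightarrow> length v = pot 0 v" for v :: "('x list \<Rightarrow> 'x list) list"
    by (induction v) (simp_all add: act_0)
  then show ?thesis using halve_nontrivial by blast
qed

text \<open>The leading pair contributes its activity at depth j + n. The rest is halved at the
  image of v under this pair, and since the pair permutes the level, summing over images is summing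
  over the level.\<close>

lemma sum_pot_halve:
  fixes w :: "('x::finite list \<Rightarrow> 'x list) list"
  assumes "\<forall>g\<in>set w. tree_aut g"
  shows "(\<Sum>v\<in>words n. pot j (halve v w)) \<le> pot (j + n) w"
  using assms
proof (induction w rule: induct_list012)
  case (2 g)
  then show ?case by (simp add: sum_act_sec)
next
  case (3 g h w)
  have t: "tree_aut h" "tree_aut g" using 3 by auto
  have "(\<Sum>v\<in>words n. pot j (halve v (g # h # w))) =
      (\<Sum>v\<in>words n. act j (sec (h \<circ> g) v)) + (\<Sum>v\<in>words n. pot j (halve ((h \<circ> g) v) w))"
    by (simp only: halve.simps pot_simps pot_nontriv sum.distrib)
  also have "(\<Sum>v\<in>words n. pot j (halve ((h \<circ> g) v) w)) = (\<Sum>v\<in>words n. pot j (halve v w))"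
    by (rule sum.reindex_bij_betw[OF tree_aut_bij_words[OF tree_aut_comp[OF t]]])
  also have "\<dots> \<le> pot (j + n) w"
    using 3 by simp
  also have "(\<Sum>v\<in>words n. act j (sec (h \<circ> g) v)) \<le> act (j + n) h + act (j + n) g"
    unfolding sum_act_sec by (rule act_comp[OF t])
  finally show ?case by simp
qed simp

section \<open>The halving transducer of a contracting set\<close>

locale nucleus =
  fixes NN :: "('x::finite list \<Rightarrow> 'x list) set" and L :: nat
    and code :: "('x list \<Rightarrow> 'x list) \<Rightarrow> nat"
  assumes finite_NN: "finite NN" and id_NN: "id \<in> NN" and ta_NN: "g \<in> NN \<Longrightarrow> tree_aut g"
    and comp_sec_NN: "g \<in> NN \<Longrightarrow> h \<in> NN \<Longrightarrow> v \<in> words L \<Longrightarrow> sec (g \<circ> h) v \<in> NN"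
    and inj_code: "inj_on code NN" and code_ge: "g \<in> NN \<Longrightarrow> 2 \<le> code g"
begin

lemma sec_NN: "g \<in> NN \<Longrightarrow> v \<in> words L \<Longrightarrow> sec g v \<in> NN"
  using comp_sec_NN[of g id v] id_NN by simp

definition dec :: "nat \<Rightarrow> 'x list \<Rightarrow> 'x list" where
  "dec = inv_into NN code"

lemma dec_code [simp]: "g \<in> NN \<Longrightarrow> dec (code g) = g"
  by (simp add: dec_def inj_code)

lemma code_neq_1 [simp]: "g \<in> NN \<Longrightarrow> code g \<noteq> Suc 0"
  using code_ge[of g] by auto

text \<open>In a state \<open>(v, u, ps, big)\<close>, \<open>v\<close> is the vertex at which the sections are taken and \<open>u\<close> its
image under the pairs of letters of the current word read so far, \<open>ps\<close> holds an unpaired letter,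
and \<open>big\<close> tells whether a pair has been read. The symbol \<open>1\<close> ends a word.\<close>

fun \<delta> :: "'x list \<times> 'x list \<times> nat list \<times> bool \<Rightarrow> nat \<Rightarrow>
    (('x list \<times> 'x list \<times> nat list \<times> bool) \<times> nat list) option" where
  "\<delta> (v, u, [], big) a =
    (if a = 1 then
       (if big \<and> u \<noteq> v then None else Some ((v, v, [], False), if big then [1] else []))
     else Some ((v, u, [a], big), []))"
| "\<delta> (v, u, b # bs, big) a =
    (if a = 1 then
       (if big then
          (if dec b u = v then Some ((v, v, [], False), map code (nontriv (sec (dec b) u)) @ [1]) else None)
        else (if dec b = id then Some ((v, v, [], False), []) else None))
     else Some ((v, (dec a \<circ> dec b) u, [], True), map code (nontriv (sec (dec a \<circ> dec b) u))))"

definition Q :: "('x list \<times> 'x list \<times> nat list \<times> bool) set" where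
  "Q = words L \<times> words L \<times> {ps. set ps \<subseteq> code ` NN \<and> length ps \<le> 1} \<times> UNIV"

text \<open>The blank is 0 and the end marker 1, whence the codes of letters start at 2.\<close>

definition Sy :: "nat set" where
  "Sy = insert 1 (code ` NN)"

abbreviation init :: "'x list \<Rightarrow> 'x list \<times> 'x list \<times> nat list \<times> bool" where
  "init v \<equiv> (v, v, [], False)"

lemma finite_Q: "finite Q"
  unfolding Q_def by (intro finite_cartesian_product finite_lists_length_le finite_imageI finite_NN) auto

lemma \<delta>_closed:
  assumes "q \<in> Q" "a \<in> Sy" "\<delta> q a = Some (q', ys)"
  shows "q' \<in> Q \<and> set ys \<subseteq> Sy \<and> length ys \<le> 2"
proof -
  have nt: "(\<forall>x\<in>set (nontriv g). code x \<in> code ` NN) \<and> length (nontriv g) \<le> 1" if "g \<in> NN" for g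
    using that by (auto simp: nontriv_def)
  obtain v u ps big where q: "q = (v, u, ps, big)" by (cases q)
  then have l: "length v = L" "length u = L" "set ps \<subseteq> code ` NN" "length ps \<le> 1"
    using assms(1) by (auto simp: Q_def)
  show ?thesis
  proof (cases ps)
    case Nil
    then show ?thesis using assms l q by (auto simp: Q_def Sy_def split: if_splits)
  next
    case (Cons b bs)
    then obtain g where g: "g \<in> NN" "b = code g" and bs: "bs = []" using l by auto
    show ?thesis
    proof (cases "a = 1")
      case True
      then show ?thesis using assms l q Cons g bs nt[OF sec_NN[of g u]]
        by (auto simp: Q_def Sy_def split: if_splits)
    next
      case False
      then obtain h where h: "h \<in> NN" "a = code h" using assms(2) by (auto simp: Sy_def)
      have "length ((h \<circ> g) u) = L"
        using l by (simp add: tree_aut_length[OF ta_NN[OF h(1)]] tree_aut_length[OF ta_NN[OF g(1)]])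
      then show ?thesis using False assms l q Cons g bs h nt[OF comp_sec_NN[of h g u]]
        by (auto simp: Q_def Sy_def)
    qed
  qed
qed

section \<open>Effect of a round on the words on the tape\<close>

definition flat :: "('x list \<Rightarrow> 'x list) list list \<Rightarrow> nat list" where
  "flat ws = concat (map (\<lambda>w. map code w @ [1]) ws)"

lemma flat_simps [simp]: "flat [] = []" "flat (w # ws) = map code w @ 1 # flat ws"
  "flat (ws @ ws') = flat ws @ flat ws'"
  by (simp_all add: flat_def)

text \<open>What a pass at v can check: a word of at most one letter is decided completely, a longer
  one is only tested at v and the remaining question is left to its sections.\<close>

definition okw :: "'x list \<Rightarrow> ('x list \<Rightarrow> 'x list) list \<Rightarrow> bool" where
  "okw v w \<longleftrightarrow> (if length w \<le> 1 then prodw w = id else prodw w v = v)"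

text \<open>Once a pair has been read the transducer follows the recursion of \<open>halve\<close>;
  u is then the image of v under the earlier pairs, so the test against v concerns the whole
  word.\<close>

lemma trun_True:
  assumes "set w \<subseteq> NN"
  shows "trun \<delta> (v, u, [], True) (map code w @ 1 # c) =
    (if prodw w u = v then map_option ((@) (map code (halve u w) @ [1])) (trun \<delta> (init v) c) else None)"
  using assms
proof (induction u w rule: halve.induct)
  case (3 u g h w)
  then show ?case by (cases "trun \<delta> (init v) c") auto
qed (cases "trun \<delta> (init v) c"; auto)+

lemma trun_word:
  assumes "set w \<subseteq> NN"
  shows "trun \<delta> (init v) (map code w @ 1 # c) =
    (if okw v w then map_option ((@) (if 2 \<le> length w then map code (halve v w) @ [1] else []))
       (trun \<delta> (init v) c) else None)"
proof -
  consider "w = []" | g where "w = [g]" | g h w' where "w = g # h # w'"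
    by (metis list.exhaust)
  then show ?thesis
  proof cases
    case (3 g h w')
    then show ?thesis using assms trun_True[of w' v "(h \<circ> g) v" c]
      by (cases "trun \<delta> (init v) c") (auto simp: okw_def)
  qed (use assms in \<open>cases "trun \<delta> (init v) c"; auto simp: okw_def\<close>)+
qed

lemma trun_flat:
  assumes "\<forall>w\<in>set ws. set w \<subseteq> NN"
  shows "trun \<delta> (init v) (flat ws) =
    (if \<forall>w\<in>set ws. okw v w then Some (flat (map (halve v) (filter (\<lambda>w. 2 \<le> length w) ws))) else None)"
  using assms
proof (induction ws)
  case (Cons w ws)
  then show ?case by (auto simp: trun_word[unfolded One_nat_def] simp del: trun.simps)
qed simp

definition next_words where
  "next_words vs ws = concat (map (\<lambda>v. map (halve v) (filter (\<lambda>w. 2 \<le> length w) ws)) vs)"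

lemma level_flat:
  assumes "\<forall>w\<in>set ws. set w \<subseteq> NN" "c @ [1] = flat ws"
  shows "level \<delta> (map init vs) c =
    (if \<forall>v\<in>set vs. \<forall>w\<in>set ws. okw v w then Some (flat (next_words vs ws)) else None)"
proof (induction vs)
  case (Cons v vs)
  then show ?case using trun_flat[OF assms(1), of v]
    by (auto simp: next_words_def assms(2)[simplified])
qed (simp add: next_words_def)

lemma trivial_iff:
  assumes "set w \<subseteq> NN"
  shows "prodw w = id \<longleftrightarrow>
    (\<forall>v\<in>words L. okw v w \<and> (2 \<le> length w \<longrightarrow> prodw (halve v w) = id))"
proof (cases "length w \<le> 1")
  case True
  \<comment> \<open>For a short word \<open>okw\<close> does not depend on v, so the level has to be
    nonempty for the condition to say anything.\<close>
  obtain v :: "'x list" where "length v = L" by (meson length_replicate)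
  then show ?thesis using True by (auto simp: okw_def)
next
  case False
  have t: "\<forall>g\<in>set w. tree_aut g" using assms ta_NN by auto
  show ?thesis
    using tree_aut_eq_id_iff[OF tree_aut_prodw[OF t], of L] False
    by (auto simp: okw_def prodw_halve[OF t])
qed

lemma halve_NN: "set w \<subseteq> NN \<Longrightarrow> u \<in> words L \<Longrightarrow> set (halve u w) \<subseteq> NN"
proof (induction u w rule: halve.induct)
  case (2 u g)
  then show ?case by (auto simp: nontriv_def intro: sec_NN)
next
  case (3 u g h w)
  then have gh: "g \<in> NN" "h \<in> NN" "length u = L" by auto
  then have "length ((h \<circ> g) u) = L"
    by (simp add: tree_aut_length[OF ta_NN[OF gh(1)]] tree_aut_length[OF ta_NN[OF gh(2)]])
  moreover have "sec (h \<circ> g) u \<in> NN" using gh by (intro comp_sec_NN) auto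
  ultimately show ?case using 3 by (auto simp: nontriv_def)
qed simp

section \<open>Size and correctness over many rounds\<close>

lemma pot_next_words:
  assumes "\<forall>w\<in>set ws. set w \<subseteq> NN" "distinct vs" "set vs = words L"
  shows "(\<Sum>w\<leftarrow>next_words vs ws. pot j w) \<le> (\<Sum>w\<leftarrow>ws. pot (j + L) w)"
proof -
  let ?f = "\<lambda>v ws. \<Sum>w\<leftarrow>filter (\<lambda>w. 2 \<le> length w) ws. pot j (halve v w)"
  have "(\<Sum>w\<leftarrow>next_words vs ws. pot j w) = (\<Sum>v\<leftarrow>vs. ?f v ws)"
    unfolding next_words_def by (induction vs) (simp_all add: comp_def)
  also have "\<dots> = (\<Sum>v\<in>words L. ?f v ws)"
    unfolding sum_list_distinct_conv_sum_set[OF assms(2)] assms(3) ..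
  also have "\<dots> \<le> (\<Sum>w\<leftarrow>ws. pot (j + L) w)"
    using assms(1)
  proof (induction ws)
    case (Cons w ws)
    have "(\<Sum>v\<in>words L. pot j (halve v w)) \<le> pot (j + L) w"
      using Cons.prems ta_NN by (intro sum_pot_halve) auto
    then show ?case using Cons by (auto simp: sum.distrib)
  qed simp
  finally show ?thesis .
qed

text \<open>The potential is bounded for every j because a round trades depth j for depth j + L.
  Each of at most m long words has p successors, which gives \<open>p * m\<close>; the additional
  word is the one closed by the implicit marker. With fuel \<open>Suc k'\<close> lengths are at most
  \<open>2 ^ k'\<close>, so after \<open>k' = 0\<close> nothing is left to write.\<close>

definition content_inv :: "nat \<Rightarrow> nat \<Rightarrow> bool \<Rightarrow> nat \<Rightarrow> nat list \<Rightarrow> bool" where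
  "content_inv p m t k c \<longleftrightarrow> (\<exists>ws. c @ [1] = flat ws \<and> (\<forall>w\<in>set ws. set w \<subseteq> NN) \<and>
     (\<forall>j. (\<Sum>w\<leftarrow>ws. pot j w) \<le> m) \<and> (\<Sum>w\<leftarrow>ws. length w) \<le> m \<and> length ws \<le> p * m + 1 \<and>
     ((\<forall>w\<in>set ws. prodw w = id) \<longleftrightarrow> t) \<and>
     (case k of 0 \<Rightarrow> c = [] | Suc k' \<Rightarrow> \<forall>w\<in>set ws. length w \<le> 2 ^ k'))"

lemma content_inv_symbols:
  assumes "content_inv p m t k c" shows "set c \<subseteq> Sy"
proof -
  obtain ws where "c @ [1] = flat ws" "\<forall>w\<in>set ws. set w \<subseteq> NN"
    using assms by (auto simp: content_inv_def)
  moreover from this(2) have "set (flat ws) \<subseteq> Sy" by (induction ws) (auto simp: Sy_def)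
  ultimately show ?thesis by (metis Un_subset_iff set_append)
qed

lemma content_inv_length:
  assumes "content_inv p m t k c" shows "length c \<le> m + p * m"
proof -
  obtain ws where ws: "c @ [1] = flat ws" "(\<Sum>w\<leftarrow>ws. length w) \<le> m" "length ws \<le> p * m + 1"
    using assms by (auto simp: content_inv_def)
  have "length (flat ws) = (\<Sum>w\<leftarrow>ws. length w) + length ws" by (induction ws) auto
  moreover have "length (flat ws) = length c + 1" by (simp flip: ws(1))
  ultimately show ?thesis using ws by simp
qed

text \<open>Together with the implicit marker an empty tape encodes exactly one word, the empty
  one.\<close>

lemma content_inv_Nil:
  assumes "content_inv p m t k []" shows t
proof -
  obtain ws where ws: "[1] = flat ws" "\<forall>w\<in>set ws. set w \<subseteq> NN" "(\<forall>w\<in>set ws. prodw w = id) \<longleftrightarrow> t"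
    using assms by (auto simp: content_inv_def)
  have "length (flat ws) = (\<Sum>w\<leftarrow>ws. length w) + length ws" by (induction ws) auto
  then have "(\<Sum>w\<leftarrow>ws. length w) + length ws = 1" by (simp flip: ws(1))
  then have "\<forall>w\<in>set ws. w = []" by (cases ws) auto
  then show t using ws(3) by auto
qed

lemma content_inv_level_None:
  assumes "content_inv p m t k c" "level \<delta> (map init vs) c = None" "set vs = words L"
  shows "\<not> t"
proof -
  obtain ws where ws: "c @ [1] = flat ws" "\<forall>w\<in>set ws. set w \<subseteq> NN" "(\<forall>w\<in>set ws. prodw w = id) \<longleftrightarrow> t"
    using assms by (auto simp: content_inv_def)
  then obtain v w where "v \<in> words L" "w \<in> set ws" "\<not> okw v w"
    using level_flat[of ws c vs] assms by (auto split: if_splits)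
  then have "prodw w \<noteq> id" using trivial_iff[of w] ws(2) by blast
  then show ?thesis using ws \<open>w \<in> set ws\<close> by auto
qed

lemma content_inv_level_Some:
  assumes inv: "content_inv (length vs) m t k c" and c: "c \<noteq> []"
    and lv: "level \<delta> (map init vs) c = Some c'"
    and vs: "set vs = words L" "distinct vs"
  shows "\<exists>k'. k = Suc k' \<and> content_inv (length vs) m t k' c'"
proof -
  obtain ws where ws: "c @ [1] = flat ws" "\<forall>w\<in>set ws. set w \<subseteq> NN" "\<And>j. (\<Sum>w\<leftarrow>ws. pot j w) \<le> m"
    "(\<Sum>w\<leftarrow>ws. length w) \<le> m" "(\<forall>w\<in>set ws. prodw w = id) \<longleftrightarrow> t"
    and k: "case k of 0 \<Rightarrow> c = [] | Suc k' \<Rightarrow> \<forall>w\<in>set ws. length w \<le> 2 ^ k'"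
    using inv by (auto simp: content_inv_def)
  obtain k' where k': "k = Suc k'" "\<forall>w\<in>set ws. length w \<le> 2 ^ k'"
    using k c by (cases k) auto
  have ok: "\<forall>v\<in>words L. \<forall>w\<in>set ws. okw v w" and c': "c' = flat (next_words vs ws)"
    using level_flat[OF ws(2,1), of vs] lv vs by (auto split: if_splits)
  \<comment> \<open>Every word written in a round carries its own marker, so the implicit marker
    closes an additional empty word.\<close>
  let ?ws = "next_words vs ws @ [[]]"
  have set_next: "set (next_words vs ws) = {halve v w | v w. v \<in> words L \<and> w \<in> set ws \<and> 2 \<le> length w}"
    using vs by (auto simp: next_words_def)
  have NN: "\<forall>w\<in>set ?ws. set w \<subseteq> NN"
    using ws(2) halve_NN set_next by fastforce
  have pot: "(\<Sum>w\<leftarrow>?ws. pot j w) \<le> m" for j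
    using pot_next_words[OF ws(2) vs(2,1), of j] ws(3)[of "j + L"] by simp
  \<comment> \<open>Halved words contain nontrivial letters only, so their length is their potential
    at depth 0 and inherits its bound.\<close>
  have "map length (next_words vs ws) = map (pot 0) (next_words vs ws)"
    using set_next length_halve_pot by (intro map_cong) auto
  then have "(\<Sum>w\<leftarrow>next_words vs ws. length w) = (\<Sum>w\<leftarrow>next_words vs ws. pot 0 w)"
    by (rule arg_cong)
  then have len: "(\<Sum>w\<leftarrow>?ws. length w) \<le> m"
    using pot[of 0] by simp
  have num: "length ?ws \<le> length vs * m + 1"
  proof -
    have "length (next_words vs ws) = length vs * length (filter (\<lambda>w. 2 \<le> length w) ws)"
      unfolding next_words_def by (induction vs) auto
    moreover have "length (filter (\<lambda>w. 2 \<le> length w) ws) \<le> (\<Sum>w\<leftarrow>ws. length w)"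
      by (induction ws) auto
    ultimately show ?thesis using ws(4) by (simp add: order_trans)
  qed
  have triv: "(\<forall>w\<in>set ?ws. prodw w = id) \<longleftrightarrow> t"
  proof -
    have "(\<forall>w\<in>set ws. prodw w = id) \<longleftrightarrow>
        (\<forall>w\<in>set ws. \<forall>v\<in>words L. 2 \<le> length w \<longrightarrow> prodw (halve v w) = id)"
      using trivial_iff ws(2) ok by blast
    then show ?thesis using ws(5) set_next by auto
  qed
  have fuel: "case k' of 0 \<Rightarrow> c' = [] | Suc k'' \<Rightarrow> \<forall>w\<in>set ?ws. length w \<le> 2 ^ k''"
  proof (cases k')
    case 0
    then have "filter (\<lambda>w. 2 \<le> length w) ws = []" using k' by (force simp: filter_empty_conv)
    then show ?thesis using 0 c' by (simp add: next_words_def flat_def)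
  next
    case (Suc k'')
    \<comment> \<open>The unpaired letter does no harm: twice the new length is at most
      \<open>2 * 2 ^ k'' + 1\<close>, and parity removes the 1.\<close>
    have "length (halve v w) \<le> 2 ^ k''" if "w \<in> set ws" for v w
      using length_halve[of v w] k'(2) Suc that by fastforce
    then show ?thesis using Suc set_next by auto
  qed
  have "c' @ [1] = flat ?ws" by (simp add: c')
  then have "content_inv (length vs) m t k' c'"
    unfolding content_inv_def using NN pot len num triv fuel by blast
  then show ?thesis using k' by blast
qed

section \<open>The machine for the word problem over a contracting set\<close>

lemma word_problem_machine:
  fixes f :: "'s \<Rightarrow> 'x list \<Rightarrow> 'x list" and \<kappa> :: "nat \<Rightarrow> nat"
  assumes f: "range f \<subseteq> NN" "inj f" and C: "\<And>s n. act n (f s) \<le> C" and \<kappa>: "\<And>n. n \<le> 2 ^ \<kappa> n"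
  shows "\<exists>(M :: 's tm) D. wf_tm M \<and> tm_decides M {w. prodw (rev (map f w)) = id} \<and>
    (\<forall>w. tm_time M w \<le> (\<kappa> (length w) + 2) * (D * (length w + 1)))"
proof -
  obtain vs :: "'x list list" where vs: "set vs = words L" "distinct vs"
    using finite_distinct_list[OF finite_words] by blast
  \<comment> \<open>The machine needs a first pass, hence at least one vertex on the level.\<close>
  have "replicate L undefined \<in> set vs" using vs by simp
  then obtain v0 vs' where vs0: "vs = v0 # vs'" by (cases vs) auto
  define en where "en = (\<lambda>s. code (f s))"
  define p where "p = length vs"
  interpret T: iterated_transducer \<delta> Q "init v0" "map init vs'" Sy en
  proof unfold_locales
    show "finite Q" by (rule finite_Q)
    show "set (init v0 # map init vs') \<subseteq> Q" using vs vs0 by (force simp: Q_def)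
    show "finite Sy" "0 \<notin> Sy" "1 \<in> Sy" using finite_NN code_ge by (force simp: Sy_def)+
    have "inj (code \<circ> f)" by (intro comp_inj_on f(2) inj_on_subset[OF inj_code f(1)])
    then show "inj en" by (simp add: en_def comp_def)
    show "range en \<subseteq> Sy" using f by (auto simp: en_def Sy_def)
  qed (rule \<delta>_closed)
  define L where "L = {w. prodw (rev (map f w)) = id}"
  \<comment> \<open>The cost of a round per unit of \<open>length w + 1\<close>: p passes over at
    most \<open>m + p * m\<close> symbols, and one step for the emptiness test.\<close>
  define D where "D = p * (4 * ((C + 1) + p * (C + 1)) + 5) + 1"
  have qs: "init v0 # map init vs' = map init vs" by (simp add: vs0)
  have time: "\<exists>y. reaches T.machine ((\<kappa> (length w) + 2) * (D * (length w + 1))) (tm_init T.machine w) y \<and>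
      fst y = (if w \<in> L then accept T.machine else reject T.machine)" for w
  proof -
    \<comment> \<open>The summand C covers the activity of the input at every depth, the summand 1
      its length.\<close>
    define m where "m = (C + 1) * length w"
    define t where "t \<longleftrightarrow> w \<in> L"
    let ?w = "rev (map f w)"
    let ?c = "rev (map en w)"
    have start: "content_inv p m t (Suc (\<kappa> (length w))) ?c"
      unfolding content_inv_def
    proof (intro exI[of _ "[?w]"] conjI allI)
      show "?c @ [1] = flat [?w]" by (simp add: en_def comp_def flip: rev_map)
      show "\<forall>w\<in>set [?w]. set w \<subseteq> NN" using f by auto
      have "pot j ?w \<le> C * length w" for j
      proof (induction w)
        case (Cons s w)
        then show ?case using C[of j s] by simp
      qed simp
      then show "(\<Sum>w\<leftarrow>[?w]. pot j w) \<le> m" for j by (simp add: m_def trans_le_add2)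
      show "(\<forall>w\<in>set [?w]. prodw w = id) = t" by (simp add: t_def L_def)
    qed (use \<kappa> in \<open>simp_all add: m_def\<close>)
    have "\<exists>y. reaches T.machine ((Suc (\<kappa> (length w)) + 1) *
          (length (init v0 # map init vs') * (4 * (m + p * m) + 5) + 1))
        (T.conf False Chk (tape (int (length w) - 1) ?c)
          (int (length w) - 1 - int (length ?c) + 1) (\<lambda>_. 0) 0) y \<and> fst y = (if t then 0 else 1)"
    proof (rule T.iterate_run[where Inv = "content_inv p m t"])
      show "set c \<subseteq> Sy" if "content_inv p m t k c" for k c
        using that by (rule content_inv_symbols)
      show "length c \<le> m + p * m" if "content_inv p m t k c" for k c
        using that by (rule content_inv_length)
      show "\<exists>k'. k = Suc k' \<and> content_inv p m t k' c'"
        if "content_inv p m t k c" "c \<noteq> []" "level \<delta> (init v0 # map init vs') c = Some c'" for k c c'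
        using that vs unfolding qs p_def by (intro content_inv_level_Some)
      show "\<not> t" if "content_inv p m t k c" "level \<delta> (init v0 # map init vs') c = None" for k c
        using that vs(1) unfolding qs by (rule content_inv_level_None)
      show t if "content_inv p m t k []" for k
        using that by (rule content_inv_Nil)
    qed (rule start)
    then obtain y where y: "reaches T.machine ((\<kappa> (length w) + 2) * (p * (4 * (m + p * m) + 5) + 1))
        (tm_init T.machine w) y" "fst y = (if t then 0 else 1)"
      unfolding T.machine_init qs length_map p_def[symmetric] by auto
    have "p * (4 * (m + p * m) + 5) + 1 \<le> D * (length w + 1)"
      by (simp add: m_def D_def algebra_simps)
    then have "(\<kappa> (length w) + 2) * (p * (4 * (m + p * m) + 5) + 1)
        \<le> (\<kappa> (length w) + 2) * (D * (length w + 1))"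
      by (rule mult_le_mono2)
    with y show ?thesis
      by (intro exI[of _ y]) (auto simp: t_def T.machine_def elim: reaches_mono)
  qed
  show ?thesis
    using T.wf_machine decides_in_timeI[OF T.wf_machine time] unfolding L_def by blast
qed

end

section \<open>The time bound for the automaton group\<close>

theorem mainTheorem10:
  fixes tr :: "'s::finite \<Rightarrow> 'x::finite \<Rightarrow> 's"
    and out :: "'s \<Rightarrow> 'x \<Rightarrow> 'x"
  assumes "invertible_aut tr out"
    and "minimal_aut tr out"
    and "inverse_closed_aut tr out"
    and "bounded_aut tr out"
  shows "WP tr out \<in> DTIME_star (\<lambda>n. real n * log 2 (real n))"
proof -
  interpret bounded_invertible tr out
    using assms by unfold_locales
  obtain NN L where NN: "finite NN" "id \<in> NN" "range tf \<subseteq> NN" "\<forall>g\<in>NN. tree_aut g"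
    "\<forall>g\<in>NN. \<forall>h\<in>NN. \<forall>v\<in>words L. sec (g \<circ> h) v \<in> NN"
    using nucleus_exists by blast
  obtain cd :: "('x list \<Rightarrow> 'x list) \<Rightarrow> nat" where cd: "inj_on cd NN"
    using finite_imp_inj_to_nat_seg[OF NN(1)] by blast
  interpret nucleus NN L "\<lambda>g. cd g + 2"
    using NN cd by unfold_locales (auto simp: inj_on_def)
  obtain C where C: "\<And>s n. act n (tf s) \<le> C" using act_bounded by blast
  \<comment> \<open>For positive n a rounded-down binary logarithm: the upper estimate of n supplies
    enough rounds, the lower one bounds their number.\<close>
  have "\<exists>k. n \<le> 2 ^ (k + 1) \<and> (1 \<le> n \<longrightarrow> 2 ^ k \<le> n)" for n :: nat
  proof (cases "n = 0")
    case False
    then show ?thesis using ex_power_ivl1[of 2 n] by (auto intro: less_imp_le)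
  qed simp
  then obtain \<kappa> where \<kappa>: "\<And>n :: nat. n \<le> 2 ^ (\<kappa> n + 1)" "\<And>n :: nat. 1 \<le> n \<Longrightarrow> 2 ^ \<kappa> n \<le> n"
    by metis
  have "inj tf" using assms(2) by (simp add: minimal_aut_def)
  then obtain M :: "'s tm" and D where M: "wf_tm M" "tm_decides M {w. prodw (rev (map tf w)) = id}"
    and time: "\<And>w. tm_time M w \<le> (\<kappa> (length w) + 1 + 2) * (D * (length w + 1))"
    using word_problem_machine[of tf C "\<lambda>n. \<kappa> n + 1"] NN(3) C \<kappa>(1) by blast
  \<comment> \<open>In \<open>eval_word\<close> the last letter acts first; reading the tape from
    its right end restores the order used by \<open>prodw\<close>.\<close>
  have "prodw (rev (map tf w)) = eval_word tr out w" for w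
    by (induction w) (auto simp: eval_word_def prodw_append)
  then have L: "{w. prodw (rev (map tf w)) = id} = WP tr out" by (simp add: WP_def)
  \<comment> \<open>For n at least 2 the logarithm is at least 1, so the rounds number at most 4 log
    n and n + 1 is at most 2n, giving 8. Length 1 is excluded since n log n vanishes there.\<close>
  have "real (tm_time M w) \<le> real (8 * D) * (real (length w) * log 2 (real (length w)))"
    if n: "2 \<le> length w" for w
  proof -
    let ?n = "length w"
    have l1: "1 \<le> log 2 (real ?n)" using n by (subst le_log_iff) auto
    have "2 ^ \<kappa> ?n \<le> ?n" using \<kappa>(2) n by simp
    then have "(2::real) ^ \<kappa> ?n \<le> real ?n" by (metis of_nat_le_iff of_nat_numeral of_nat_power)
    then have k: "real (\<kappa> ?n) \<le> log 2 (real ?n)" by (intro le_log_of_power) auto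
    have "real (tm_time M w) \<le> real ((\<kappa> ?n + 1 + 2) * (D * (?n + 1)))"
      using time[of w] by (simp only: of_nat_le_iff)
    also have "\<dots> = (real (\<kappa> ?n) + 3) * (real D * (real ?n + 1))" by (simp add: algebra_simps)
    also have "\<dots> \<le> (4 * log 2 (real ?n)) * (real D * (2 * real ?n))"
      using k l1 n by (intro mult_mono) auto
    also have "\<dots> = real (8 * D) * (real ?n * log 2 (real ?n))" by simp
    finally show ?thesis .
  qed
  then show ?thesis
    using M unfolding DTIME_star_def L by blast
qed

end
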